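(* For any Hausdorff topological semilattice $X$ the following statements hold. (1) If $X$ is $k$-complete, then for every Hausdorff topological semilattice $Y$ and every continuous homomorphism $h:X\to Y$ the image $h(X)$ is closed in $Y$. (2) If $X$ is $s$-complete, then for every well-separated Hausdorff topological semilattice $Y$ and every continuous homomorphism $h:X\to Y$ the image $h(X)$ is closed in $Y$. (3) If $X$ is $c$-complete, then for every down-open Hausdorff topological semilattice $Y$ and every continuous homomorphism $h:X\to Y$ the image $h(X)$ is closed in $Y$. (4) If $X$ is $c$-complete and down-open, then for every Hausdorff topological semilattice $Y$ and every continuous homomorphism $h:X\to Y$ the image $h(X)$ is closed in $Y$.
   Context: A topological semilattice is a topological space $X$ with a continuous binary operation $(x,y)\mapsto xy$ that is associative, commutative and idempotent. The natural partial order on a semilattice is: $x\le y$ iff $xy=x$. A chain is a subset in which any two elements are comparable. For $A\subset X$, ${\downarrow}A=\{x\in X:\exists a\in A\ (x\le a)\}$ and ${\uparrow}A=\{x\in X:\exists a\in A\ (x\ge a)\}$; $A$ is an upper set if $A={\uparrow}A$. $\overline{A}$ denotes topological closure. A topological semilattice $X$ is: - $k$-complete if each non-empty chain $C\subset X$ has $\inf C\in\overline{C}$ and $\sup C\in\overline{C}$ (in particular, both exist in $X$); - $s$-complete if each non-empty subsemilattice $S\subset X$ has $\inf S\in\overline{{\uparrow}S}$ and each non-empty chain $C\subset X$ has $\sup C\in\overline{{\downarrow}C}$ (existence included); - $c$-complete if for each closed upper set $F\subset X$, each non-empty chain $C\subset F$ has $\inf C\in F$ and $\sup C\in\overline{{\downarrow}C}$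 in $X$ (existence included). A Hausdorff topological semilattice $Y$ (with its natural order) is well-separated if for any points $x<y$ in $Y$ there is a neighborhood $V\subset Y$ of $y$ with $x\notin{\uparrow}\overline{{\uparrow}\overline{{\uparrow}V}}$; it is down-open if for every open $U\subset Y$ the set ${\downarrow}U$ is open in $Y$. *)

theory Defs
  imports "HOL-Analysis.Abstract_Topological_Spaces"
begin

text \<open>
  A topological semilattice is a pair of a topology \<open>X\<close> and an operation \<open>m\<close> that is only
  constrained on \<open>topspace X\<close>; the order notions below are relative to that carrier as well.
\<close>

locale topological_semilattice =
  fixes X :: "'a topology" and m :: "'a \<Rightarrow> 'a \<Rightarrow> 'a"
  assumes closed: "\<lbrakk>x \<in> topspace X; y \<in> topspace X\<rbrakk> \<Longrightarrow> m x y \<in> topspace X"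
    and assoc: "\<lbrakk>x \<in> topspace X; y \<in> topspace X; z \<in> topspace X\<rbrakk>
      \<Longrightarrow> m (m x y) z = m x (m y z)"
    and commute: "\<lbrakk>x \<in> topspace X; y \<in> topspace X\<rbrakk> \<Longrightarrow> m x y = m y x"
    and idem: "x \<in> topspace X \<Longrightarrow> m x x = x"
    and continuous: "continuous_map (prod_topology X X) X (\<lambda>(x, y). m x y)"

definition sl_le :: "('a \<Rightarrow> 'a \<Rightarrow> 'a) \<Rightarrow> 'a \<Rightarrow> 'a \<Rightarrow> bool" where
  "sl_le m x y \<longleftrightarrow> m x y = x"

definition sl_chain :: "'a topology \<Rightarrow> ('a \<Rightarrow> 'a \<Rightarrow> 'a) \<Rightarrow> 'a set \<Rightarrow> bool" where
  "sl_chain X m C \<longleftrightarrow> C \<subseteq> topspace X \<and> Complete_Partial_Order.chain (sl_le m) C"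

definition subsemilattice :: "'a topology \<Rightarrow> ('a \<Rightarrow> 'a \<Rightarrow> 'a) \<Rightarrow> 'a set \<Rightarrow> bool" where
  "subsemilattice X m S \<longleftrightarrow> S \<subseteq> topspace X \<and> (\<forall>x\<in>S. \<forall>y\<in>S. m x y \<in> S)"

definition down_set :: "'a topology \<Rightarrow> ('a \<Rightarrow> 'a \<Rightarrow> 'a) \<Rightarrow> 'a set \<Rightarrow> 'a set" where
  "down_set X m A = {x \<in> topspace X. \<exists>a\<in>A. sl_le m x a}"

definition up_set :: "'a topology \<Rightarrow> ('a \<Rightarrow> 'a \<Rightarrow> 'a) \<Rightarrow> 'a set \<Rightarrow> 'a set" where
  "up_set X m A = {x \<in> topspace X. \<exists>a\<in>A. sl_le m a x}"

text \<open>
  Infima and suprema need not exist, so they are relations; assertions about \<open>inf A\<close> or \<open>sup A\<close>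
  are phrased with an existential quantifier, which includes the existence claim.
\<close>

definition is_inf :: "'a topology \<Rightarrow> ('a \<Rightarrow> 'a \<Rightarrow> 'a) \<Rightarrow> 'a set \<Rightarrow> 'a \<Rightarrow> bool" where
  "is_inf X m A x \<longleftrightarrow> x \<in> topspace X \<and> (\<forall>a\<in>A. sl_le m x a) \<and>
     (\<forall>y\<in>topspace X. (\<forall>a\<in>A. sl_le m y a) \<longrightarrow> sl_le m y x)"

definition is_sup :: "'a topology \<Rightarrow> ('a \<Rightarrow> 'a \<Rightarrow> 'a) \<Rightarrow> 'a set \<Rightarrow> 'a \<Rightarrow> bool" where
  "is_sup X m A x \<longleftrightarrow> x \<in> topspace X \<and> (\<forall>a\<in>A. sl_le m a x) \<and>
     (\<forall>y\<in>topspace X. (\<forall>a\<in>A. sl_le m a y) \<longrightarrow> sl_le m x y)"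

definition k_complete :: "'a topology \<Rightarrow> ('a \<Rightarrow> 'a \<Rightarrow> 'a) \<Rightarrow> bool" where
  "k_complete X m \<longleftrightarrow> (\<forall>C. sl_chain X m C \<and> C \<noteq> {} \<longrightarrow>
     (\<exists>x. is_inf X m C x \<and> x \<in> X closure_of C) \<and>
     (\<exists>x. is_sup X m C x \<and> x \<in> X closure_of C))"

definition s_complete :: "'a topology \<Rightarrow> ('a \<Rightarrow> 'a \<Rightarrow> 'a) \<Rightarrow> bool" where
  "s_complete X m \<longleftrightarrow>
     (\<forall>S. subsemilattice X m S \<and> S \<noteq> {} \<longrightarrow>
        (\<exists>x. is_inf X m S x \<and> x \<in> X closure_of (up_set X m S))) \<and>
     (\<forall>C. sl_chain X m C \<and> C \<noteq> {} \<longrightarrow>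
        (\<exists>x. is_sup X m C x \<and> x \<in> X closure_of (down_set X m C)))"

definition c_complete :: "'a topology \<Rightarrow> ('a \<Rightarrow> 'a \<Rightarrow> 'a) \<Rightarrow> bool" where
  "c_complete X m \<longleftrightarrow>
     (\<forall>F. closedin X F \<and> F = up_set X m F \<longrightarrow>
        (\<forall>C. sl_chain X m C \<and> C \<noteq> {} \<and> C \<subseteq> F \<longrightarrow>
           (\<exists>x. is_inf X m C x \<and> x \<in> F) \<and>
           (\<exists>x. is_sup X m C x \<and> x \<in> X closure_of (down_set X m C))))"

text \<open>Neighbourhoods need not be open.\<close>

definition well_separated :: "'a topology \<Rightarrow> ('a \<Rightarrow> 'a \<Rightarrow> 'a) \<Rightarrow> bool" where
  "well_separated Y n \<longleftrightarrow>
     (\<forall>x\<in>topspace Y. \<forall>y\<in>topspace Y. sl_le n x y \<and> x \<noteq> y \<longrightarrow>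
        (\<exists>V. V \<subseteq> topspace Y \<and> y \<in> Y interior_of V \<and>
           x \<notin> up_set Y n (Y closure_of up_set Y n (Y closure_of up_set Y n V))))"

definition down_open :: "'a topology \<Rightarrow> ('a \<Rightarrow> 'a \<Rightarrow> 'a) \<Rightarrow> bool" where
  "down_open Y n \<longleftrightarrow> (\<forall>U. openin Y U \<longrightarrow> openin Y (down_set Y n U))"

definition continuous_hom ::
  "'a topology \<Rightarrow> ('a \<Rightarrow> 'a \<Rightarrow> 'a) \<Rightarrow> 'b topology \<Rightarrow> ('b \<Rightarrow> 'b \<Rightarrow> 'b) \<Rightarrow> ('a \<Rightarrow> 'b) \<Rightarrow> bool" where
  "continuous_hom X m Y n h \<longleftrightarrow> continuous_map X Y h \<and>
     (\<forall>x\<in>topspace X. \<forall>y\<in>topspace X. h (m x y) = n (h x) (h y))"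

end

theory Submission
  imports Defs
begin

text \<open>
  Let \<open>y\<close> lie in the closure of \<open>h(X)\<close>. For open neighbourhoods \<open>U i\<close> of \<open>y\<close> with
  \<open>U (i+1) U (i+1) \<subseteq> U i\<close> and points \<open>x i\<close> with \<open>h (x i) \<in> U i\<close>, the infima
  \<open>z i = inf {x i \<cdots> x k | k \<ge> i}\<close> increase with \<open>i\<close>, and their supremum lies in a subsemilattice
  \<open>K U\<close> approximating \<open>\<Inter>i. h\<^sup>-\<^sup>1 (U i)\<close>. The \<open>K U\<close> form a filtered family, and Zorn's
  lemma gives a point common to suitable modifications of them, which is mapped to \<open>y\<close>. If \<open>X\<close> is
  \<open>k\<close>-complete, \<open>\<Inter>i. h\<^sup>-\<^sup>1 (closure (U i))\<close> itself works. In the other cases the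
  approximations are upper sets, which only force images to lie above \<open>y\<close>; their infima are mapped below
  \<open>y\<close>, so one uses the parts of the cones over these infima that are mapped below \<open>y\<close>.
\<close>

subsection \<open>Order and topology of a Hausdorff semilattice\<close>

locale hausdorff_semilattice = topological_semilattice +
  assumes hausdorff: "Hausdorff_space X"
begin

abbreviation le (infix "\<sqsubseteq>" 50) where "x \<sqsubseteq> y \<equiv> sl_le m x y"

lemma le_refl: "x \<in> topspace X \<Longrightarrow> x \<sqsubseteq> x"
  by (simp add: sl_le_def idem)

lemma le_trans:
  "\<lbrakk>x \<sqsubseteq> y; y \<sqsubseteq> z; x \<in> topspace X; y \<in> topspace X; z \<in> topspace X\<rbrakk> \<Longrightarrow> x \<sqsubseteq> z"
  by (metis sl_le_def assoc)

lemma le_antisym: "\<lbrakk>x \<sqsubseteq> y; y \<sqsubseteq> x; x \<in> topspace X; y \<in> topspace X\<rbrakk> \<Longrightarrow> x = y"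
  by (metis sl_le_def commute)

lemma mult_le1: "\<lbrakk>x \<in> topspace X; y \<in> topspace X\<rbrakk> \<Longrightarrow> m x y \<sqsubseteq> x"
  by (metis sl_le_def assoc commute idem)

lemma mult_le2: "\<lbrakk>x \<in> topspace X; y \<in> topspace X\<rbrakk> \<Longrightarrow> m x y \<sqsubseteq> y"
  by (metis sl_le_def assoc idem)

lemma le_mult:
  "\<lbrakk>z \<sqsubseteq> x; z \<sqsubseteq> y; x \<in> topspace X; y \<in> topspace X; z \<in> topspace X\<rbrakk> \<Longrightarrow> z \<sqsubseteq> m x y"
  by (metis sl_le_def assoc)

lemma mult_mono:
  assumes "a \<sqsubseteq> x" "b \<sqsubseteq> y" "a \<in> topspace X" "b \<in> topspace X" "x \<in> topspace X" "y \<in> topspace X"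
  shows "m a b \<sqsubseteq> m x y"
  by (meson assms closed le_mult le_trans mult_le1 mult_le2)

lemma mult_nhds:
  assumes "x \<in> topspace X" "y \<in> topspace X" "openin X W" "m x y \<in> W"
  obtains U V where "openin X U" "openin X V" "x \<in> U" "y \<in> V"
    "\<And>u v. u \<in> U \<Longrightarrow> v \<in> V \<Longrightarrow> m u v \<in> W"
proof -
  have "openin (prod_topology X X) {p \<in> topspace (prod_topology X X). (\<lambda>(x, y). m x y) p \<in> W}"
    using continuous assms(3) by (rule openin_continuous_map_preimage)
  moreover have "(x, y) \<in> {p \<in> topspace (prod_topology X X). (\<lambda>(x, y). m x y) p \<in> W}"
    using assms by simp
  ultimately obtain U V where "openin X U" "openin X V" "x \<in> U" "y \<in> V"
    "U \<times> V \<subseteq> {p \<in> topspace (prod_topology X X). (\<lambda>(x, y). m x y) p \<in> W}"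
    unfolding openin_prod_topology_alt by meson
  then show thesis by (intro that[of U V]) auto
qed

lemma continuous_mult:
  assumes "x \<in> topspace X"
  shows "continuous_map X X (m x)"
proof -
  have "continuous_map X (prod_topology X X) (\<lambda>y. (x, y))"
    using assms by (simp add: continuous_map_paired)
  from continuous_map_compose[OF this continuous] show ?thesis by (simp add: o_def)
qed

lemma closedin_up: "x \<in> topspace X \<Longrightarrow> closedin X {y \<in> topspace X. x \<sqsubseteq> y}"
  unfolding sl_le_def
  by (rule closedin_continuous_maps_eq[OF hausdorff continuous_mult]) simp_all

lemma closedin_down:
  assumes "x \<in> topspace X" shows "closedin X {y \<in> topspace X. y \<sqsubseteq> x}"
proof -
  \<comment> \<open>By commutativity the lower cone is the fixed-point set of the continuous map
    \<open>m x\<close>, an equalizer of two maps into a Hausdorff space.\<close>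
  have "{y \<in> topspace X. y \<sqsubseteq> x} = {y \<in> topspace X. m x y = y}"
    using commute assms unfolding sl_le_def by force
  then show ?thesis
    using closedin_continuous_maps_eq[OF hausdorff continuous_mult[OF assms] continuous_map_id]
    by simp
qed

text \<open>Joint continuity gives a product neighbourhood of \<open>(x, y)\<close>, which meets
  \<open>A\<close> and \<open>B\<close>. Keeping \<open>C\<close> separate from the products allows
  the passage from one neighbourhood to a larger one.\<close>

lemma closure_mult:
  assumes "x \<in> X closure_of A" "y \<in> X closure_of B" "\<And>a b. a \<in> A \<Longrightarrow> b \<in> B \<Longrightarrow> m a b \<in> C"
  shows "m x y \<in> X closure_of C"
  unfolding in_closure_of
proof (intro conjI allI impI)
  have xy: "x \<in> topspace X" "y \<in> topspace X" using assms by (auto simp: in_closure_of)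
  then show "m x y \<in> topspace X" by (rule closed)
  fix T assume "m x y \<in> T \<and> openin X T"
  with xy obtain U V where "openin X U" "openin X V" "x \<in> U" "y \<in> V"
    and UV: "\<And>u v. u \<in> U \<Longrightarrow> v \<in> V \<Longrightarrow> m u v \<in> T" by (metis mult_nhds)
  then obtain a b where "a \<in> A" "a \<in> U" "b \<in> B" "b \<in> V"
    using assms(1,2) unfolding in_closure_of by meson
  then show "\<exists>z. z \<in> C \<and> z \<in> T" using assms(3) UV by blast
qed

text \<open>If \<open>y\<close> were not below \<open>a\<close>, then \<open>m a y\<close> and
  \<open>y\<close> would have disjoint neighbourhoods. A point \<open>a'\<close> near
  \<open>a\<close> lying above some \<open>w\<close> near \<open>y\<close> satisfies
  \<open>m a' w = w\<close>, and this single point would be in both.\<close>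

lemma le_of_in_closure_up:
  assumes a: "a \<in> topspace X" and y: "y \<in> topspace X"
    and cl: "\<And>W. openin X W \<Longrightarrow> y \<in> W \<Longrightarrow> a \<in> X closure_of (up_set X m W)"
  shows "y \<sqsubseteq> a"
proof (rule ccontr)
  assume "\<not> y \<sqsubseteq> a"
  then have "m a y \<noteq> y" using a y commute by (metis sl_le_def)
  then obtain P Q where PQ: "openin X P" "openin X Q" "m a y \<in> P" "y \<in> Q" "disjnt P Q"
    using hausdorff a y closed unfolding Hausdorff_space_def by meson
  from mult_nhds[OF a y PQ(1,3)] obtain A W where AW: "openin X A" "openin X W" "a \<in> A" "y \<in> W"
    "\<And>u v. u \<in> A \<Longrightarrow> v \<in> W \<Longrightarrow> m u v \<in> P" by metis
  have "a \<in> X closure_of (up_set X m (W \<inter> Q))" using AW PQ by (intro cl) auto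
  with AW obtain a' where "a' \<in> A" "a' \<in> up_set X m (W \<inter> Q)" unfolding in_closure_of by meson
  then obtain w where w: "w \<in> W" "w \<in> Q" "w \<sqsubseteq> a'" "a' \<in> topspace X" by (auto simp: up_set_def)
  have "m a' w = w"
    using w openin_subset[OF AW(2)] by (metis commute sl_le_def subsetD)
  with AW(5)[OF \<open>a' \<in> A\<close> w(1)] w(2) PQ(5) show False by (auto simp: disjnt_iff)
qed

text \<open>If \<open>a\<close> were not below \<open>y\<close>, separate \<open>m a y\<close> from
  \<open>a\<close>. Since \<open>m a b = a\<close>, points \<open>b'\<close> near \<open>b\<close>
  make \<open>m a b'\<close> close to \<open>a\<close>; choosing \<open>b'\<close> below some
  \<open>w\<close> near \<open>y\<close> gives \<open>m (m a b') w = m a b'\<close>, a point close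
  to both \<open>m a y\<close> and \<open>a\<close>.\<close>

lemma le_of_le_closure_down:
  assumes a: "a \<in> topspace X" and y: "y \<in> topspace X"
    and cl: "\<And>W. openin X W \<Longrightarrow> y \<in> W \<Longrightarrow> \<exists>b\<in>X closure_of (down_set X m W). a \<sqsubseteq> b"
  shows "a \<sqsubseteq> y"
proof (rule ccontr)
  assume "\<not> a \<sqsubseteq> y"
  then have "m a y \<noteq> a" by (simp add: sl_le_def)
  then obtain P Q where PQ: "openin X P" "openin X Q" "m a y \<in> P" "a \<in> Q" "disjnt P Q"
    using hausdorff a y closed unfolding Hausdorff_space_def by meson
  from mult_nhds[OF a y PQ(1,3)] obtain A W where AW: "openin X A" "openin X W" "a \<in> A" "y \<in> W"
    "\<And>u v. u \<in> A \<Longrightarrow> v \<in> W \<Longrightarrow> m u v \<in> P" by metis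
  from cl[OF AW(2,4)] obtain b where b: "b \<in> X closure_of (down_set X m W)" "a \<sqsubseteq> b" by blast
  then have "b \<in> topspace X" "m a b = a" by (auto simp: in_closure_of sl_le_def)
  then obtain A' B where B: "openin X A'" "openin X B" "a \<in> A'" "b \<in> B"
    "\<And>u v. u \<in> A' \<Longrightarrow> v \<in> B \<Longrightarrow> m u v \<in> A \<inter> Q"
    using mult_nhds[of a b "A \<inter> Q"] a AW(1,3) PQ(2,4) by (metis IntI openin_Int)
  with b obtain b' where b': "b' \<in> B" "b' \<in> down_set X m W" unfolding in_closure_of by meson
  then obtain w where w: "w \<in> W" "b' \<sqsubseteq> w" "b' \<in> topspace X" by (auto simp: down_set_def)
  have "m (m a b') w = m a b'"
    using w a openin_subset[OF AW(2)] by (metis assoc sl_le_def subsetD)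
  with AW(5)[of "m a b'" w] w(1) B(3,5) b'(1) PQ(5) show False
    by (metis IntE disjnt_iff)
qed

section \<open>Zorn's lemma in a semilattice\<close>

lemma obtain_maximal:
  assumes "A \<subseteq> topspace X" "A \<noteq> {}"
    and ub: "\<And>C. sl_chain X m C \<Longrightarrow> C \<noteq> {} \<Longrightarrow> C \<subseteq> A \<Longrightarrow> \<exists>u\<in>A. \<forall>c\<in>C. c \<sqsubseteq> u"
  obtains w where "w \<in> A" "\<And>a. a \<in> A \<Longrightarrow> w \<sqsubseteq> a \<Longrightarrow> a = w"
proof -
  have "\<exists>w\<in>A. \<forall>a\<in>A. w \<sqsubseteq> a \<longrightarrow> a = w"
  proof (rule predicate_Zorn)
    show "partial_order_on A (relation_of (sl_le m) A)"
      using assms(1) le_refl le_trans le_antisym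
      by (intro partial_order_on_relation_ofI) (meson subsetD)+
    show "\<exists>u\<in>A. \<forall>a\<in>C. a \<sqsubseteq> u" if "C \<in> Chains (relation_of (sl_le m) A)" for C
    proof (cases "C = {}")
      case False
      have "C \<subseteq> A" "sl_chain X m C"
        using that assms(1) by (auto simp: Chains_def relation_of_def sl_chain_def chain_def)
      with False ub show ?thesis by blast
    qed (use assms in auto)
  qed
  then show thesis using that by blast
qed

lemma obtain_minimal:
  assumes "A \<subseteq> topspace X" "A \<noteq> {}"
    and lb: "\<And>C. sl_chain X m C \<Longrightarrow> C \<noteq> {} \<Longrightarrow> C \<subseteq> A \<Longrightarrow> \<exists>u\<in>A. \<forall>c\<in>C. u \<sqsubseteq> c"
  obtains w where "w \<in> A" "\<And>a. a \<in> A \<Longrightarrow> a \<sqsubseteq> w \<Longrightarrow> a = w"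
proof -
  have "\<exists>w\<in>A. \<forall>a\<in>A. a \<sqsubseteq> w \<longrightarrow> a = w"
  proof (rule predicate_Zorn)
    show "partial_order_on A (relation_of (\<lambda>x y. y \<sqsubseteq> x) A)"
      using assms(1) le_refl le_trans le_antisym
      by (intro partial_order_on_relation_ofI) (meson subsetD)+
    show "\<exists>u\<in>A. \<forall>a\<in>C. u \<sqsubseteq> a" if "C \<in> Chains (relation_of (\<lambda>x y. y \<sqsubseteq> x) A)" for C
    proof (cases "C = {}")
      case False
      have "C \<subseteq> A" "sl_chain X m C"
        using that assms(1) by (auto simp: Chains_def relation_of_def sl_chain_def chain_def)
      with False lb show ?thesis by blast
    qed (use assms in auto)
  qed
  then show thesis using that by blast
qed

text \<open>A minimal element \<open>w\<close> of a subsemilattice is least: \<open>m w a\<close>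
  belongs to \<open>S\<close> and lies below \<open>w\<close>, so it equals
  \<open>w\<close>.\<close>

lemma obtain_least:
  assumes "subsemilattice X m S" "S \<noteq> {}"
    and lb: "\<And>C. sl_chain X m C \<Longrightarrow> C \<noteq> {} \<Longrightarrow> C \<subseteq> S \<Longrightarrow> \<exists>u\<in>S. \<forall>c\<in>C. u \<sqsubseteq> c"
  obtains w where "w \<in> S" "\<And>a. a \<in> S \<Longrightarrow> w \<sqsubseteq> a"
proof -
  have S: "S \<subseteq> topspace X" "\<And>x y. x \<in> S \<Longrightarrow> y \<in> S \<Longrightarrow> m x y \<in> S"
    using assms(1) by (auto simp: subsemilattice_def)
  obtain w where w: "w \<in> S" "\<And>a. a \<in> S \<Longrightarrow> a \<sqsubseteq> w \<Longrightarrow> a = w"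
    using obtain_minimal[OF S(1) assms(2) lb] by blast
  have "m w a = w" if "a \<in> S" for a
    using w S that mult_le1 by (meson subsetD)
  with w(1) that show thesis by (simp add: sl_le_def)
qed

text \<open>A point lying below some element of every \<open>K \<in> \<K>\<close> is pushed up by Zorn's lemma until it
  belongs to every \<open>K\<close>: this replaces the usual transfinite passage from chains to directed sets.\<close>

lemma Inter_filtered_nonempty:
  assumes bot: "b \<in> topspace X" "\<And>x. x \<in> topspace X \<Longrightarrow> b \<sqsubseteq> x"
    and sup: "\<And>C. sl_chain X m C \<Longrightarrow> C \<noteq> {} \<Longrightarrow> \<exists>x. is_sup X m C x"
    and ne: "\<K> \<noteq> {}" "\<And>K. K \<in> \<K> \<Longrightarrow> K \<noteq> {} \<and> K \<subseteq> topspace X"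
    and filtered: "\<And>K L. K \<in> \<K> \<Longrightarrow> L \<in> \<K> \<Longrightarrow> \<exists>N\<in>\<K>. N \<subseteq> K \<inter> L"
    and least: "\<And>K x. K \<in> \<K> \<Longrightarrow> x \<in> topspace X \<Longrightarrow> \<exists>z\<in>K. x \<sqsubseteq> z \<Longrightarrow>
      \<exists>z\<in>K. x \<sqsubseteq> z \<and> (\<forall>w\<in>K. x \<sqsubseteq> w \<longrightarrow> z \<sqsubseteq> w)"
    and chain_sup: "\<And>K C x. K \<in> \<K> \<Longrightarrow> sl_chain X m C \<Longrightarrow> C \<noteq> {} \<Longrightarrow> C \<subseteq> K \<Longrightarrow> is_sup X m C x \<Longrightarrow> x \<in> K"
  shows "\<Inter>\<K> \<noteq> {}"
proof -
  define E where "E = {x \<in> topspace X. \<forall>K\<in>\<K>. \<exists>z\<in>K. x \<sqsubseteq> z}"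
  have E_sup: "\<exists>u\<in>E. \<forall>c\<in>C. c \<sqsubseteq> u" if C: "sl_chain X m C" "C \<noteq> {}" "C \<subseteq> E" for C
  proof -
    obtain u where u: "is_sup X m C u" using sup C by blast
    have "\<exists>z\<in>K. u \<sqsubseteq> z" if K: "K \<in> \<K>" for K
    proof -
      have KX: "K \<subseteq> topspace X" using ne K by blast
      have CX: "C \<subseteq> topspace X" using C by (auto simp: E_def)
      have "\<forall>c\<in>C. \<exists>z\<in>K. c \<sqsubseteq> z \<and> (\<forall>w\<in>K. c \<sqsubseteq> w \<longrightarrow> z \<sqsubseteq> w)"
        using least[OF K] C(3) K unfolding E_def by blast
      then obtain f where f: "\<And>c. c \<in> C \<Longrightarrow> f c \<in> K" "\<And>c. c \<in> C \<Longrightarrow> c \<sqsubseteq> f c"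
        "\<And>c w. c \<in> C \<Longrightarrow> w \<in> K \<Longrightarrow> c \<sqsubseteq> w \<Longrightarrow> f c \<sqsubseteq> w"
        by metis
      have mono: "f c \<sqsubseteq> f d" if "c \<in> C" "d \<in> C" "c \<sqsubseteq> d" for c d
        using f that CX KX le_trans[of c d "f d"] by blast
      have ch: "sl_chain X m (f ` C)"
        using C(1) f(1) KX mono unfolding sl_chain_def chain_def by blast
      then obtain v where v: "is_sup X m (f ` C) v" using sup C by blast
      then have "v \<in> K" using chain_sup[OF K ch _ _ v] C(2) f(1) by blast
      moreover have "c \<sqsubseteq> v" if "c \<in> C" for c
        using v f that CX KX le_trans[of c "f c" v] unfolding is_sup_def by blast
      then have "u \<sqsubseteq> v" using u v unfolding is_sup_def by blast
      ultimately show ?thesis by blast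
    qed
    with u show ?thesis unfolding is_sup_def E_def by blast
  qed
  have "b \<in> E" using bot ne(2) unfolding E_def by blast
  obtain M where M: "M \<in> E" "\<And>a. a \<in> E \<Longrightarrow> M \<sqsubseteq> a \<Longrightarrow> a = M"
  proof (rule obtain_maximal[of E])
    show "E \<subseteq> topspace X" by (auto simp: E_def)
  qed (use \<open>b \<in> E\<close> E_sup in auto)
  have "M \<in> K" if K: "K \<in> \<K>" for K
  proof -
    \<comment> \<open>The least element \<open>z\<close> of \<open>K\<close> above \<open>M\<close>
      stays in \<open>E\<close>: for any \<open>L\<close>, a member \<open>N\<close> inside both
      \<open>K\<close> and \<open>L\<close> has an element above \<open>M\<close>, which is above
      \<open>z\<close> by leastness and belongs to \<open>L\<close>. Maximality then forces
      \<open>z = M\<close>.\<close>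
    obtain z where z: "z \<in> K" "M \<sqsubseteq> z" "\<And>w. w \<in> K \<Longrightarrow> M \<sqsubseteq> w \<Longrightarrow> z \<sqsubseteq> w"
      using least[OF K, of M] M(1) K unfolding E_def by blast
    have "\<exists>w\<in>L. z \<sqsubseteq> w" if L: "L \<in> \<K>" for L
    proof -
      obtain N where N: "N \<in> \<K>" "N \<subseteq> K \<inter> L" using filtered[OF K L] by blast
      then obtain w where "w \<in> N" "M \<sqsubseteq> w" using M(1) unfolding E_def by auto
      then show ?thesis using N(2) z(3) by auto
    qed
    moreover have "z \<in> topspace X" using z(1) ne(2)[OF K] by auto
    ultimately have "z \<in> E" by (simp add: E_def)
    with M(2) z(1,2) show ?thesis by blast
  qed
  then show ?thesis by blast
qed

text \<open>The witness is \<open>z n = inf {x (n+1) \<cdots> x k | k > n}\<close> for points \<open>x k \<in> P k\<close>.\<close>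

lemma obtain_increasing_infs:
  assumes P: "\<And>n. P n \<subseteq> topspace X" "\<And>n. P n \<noteq> {}"
    and PP: "\<And>n x y. x \<in> P (Suc n) \<Longrightarrow> y \<in> P (Suc n) \<Longrightarrow> m x y \<in> P n"
    and inf: "\<And>C. sl_chain X m C \<Longrightarrow> C \<noteq> {} \<Longrightarrow> \<exists>x. is_inf X m C x"
    and Q: "\<And>n C x. sl_chain X m C \<Longrightarrow> C \<noteq> {} \<Longrightarrow> C \<subseteq> P n \<Longrightarrow> is_inf X m C x \<Longrightarrow> x \<in> Q n"
  obtains z :: "nat \<Rightarrow> 'a" where "\<And>n. z n \<in> topspace X" "\<And>n. z n \<in> Q n" "\<And>i j. i \<le> j \<Longrightarrow> z i \<sqsubseteq> z j"
    "\<And>n k. \<exists>p\<in>P k. z n \<sqsubseteq> p"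
proof -
  have "\<forall>n. \<exists>x. x \<in> P n" using P(2) by blast
  then obtain x where x: "\<And>n. x n \<in> P n" by metis
  have anti: "P (Suc n) \<subseteq> P n" for n using PP P(1) idem by (metis subsetD subsetI)
  \<comment> \<open>\<open>y n k\<close> is the right-nested product of \<open>x n\<close>, ...,
    \<open>x (n + k)\<close>. The starting index shifts under the recursion on \<open>k\<close>, so
    the recursion produces functions of that index.\<close>
  define y where "y n k = rec_nat (\<lambda>n. x n) (\<lambda>k r n. m (x n) (r (Suc n))) k n" for n k
  have y0: "y n 0 = x n" and yS: "y n (Suc k) = m (x n) (y (Suc n) k)" for n k
    by (simp_all add: y_def)
  have yX: "y n k \<in> topspace X" for n k
    using P(1) x by (induction k arbitrary: n) (auto simp: y0 yS intro!: closed)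
  \<comment> \<open>Right nesting makes a product of any length cost only one index: the head and,
    by induction, the tail both lie in \<open>P (Suc n)\<close>.\<close>
  have yP: "y (Suc n) k \<in> P n" for n k
    using x anti PP by (induction k arbitrary: n) (auto simp: y0 yS)
  have ydec: "y n (Suc k) \<sqsubseteq> y n k" for n k
  proof (induction k arbitrary: n)
    case 0 show ?case using x P(1) by (auto simp: y0 yS intro!: mult_le1)
  next
    case (Suc k) then show ?case
      using x P(1) by (auto simp: yS[of n] intro!: mult_mono le_refl yX)
  qed
  have ydec': "y n l \<sqsubseteq> y n k" if "k \<le> l" for n k l
    using that by (induction rule: dec_induct) (use yX ydec le_refl le_trans in blast)+
  have ch: "sl_chain X m (range (y n))" for n
    unfolding sl_chain_def chain_def using yX ydec' by (auto intro: nat_le_linear)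
       (metis nat_le_linear)
  define z where "z n = (SOME u. is_inf X m (range (y (Suc n))) u)" for n
  have z: "is_inf X m (range (y (Suc n))) (z n)" for n
    unfolding z_def using inf[OF ch] by (metis empty_not_UNIV image_is_empty someI_ex)
  show thesis
  proof
    show zX: "z n \<in> topspace X" for n using z by (auto simp: is_inf_def)
    show "z n \<in> Q n" for n using Q[OF ch _ _ z] yP by blast
    \<comment> \<open>Dropping the first factor of a product makes it larger, so \<open>z n\<close>
      is a lower bound of the products that start one index later.\<close>
    have zS: "z n \<sqsubseteq> z (Suc n)" for n
    proof -
      have "z n \<sqsubseteq> y (Suc (Suc n)) k" for k
      proof -
        have "z n \<sqsubseteq> y (Suc n) (Suc k)" using z by (auto simp: is_inf_def)
        moreover have "y (Suc n) (Suc k) \<sqsubseteq> y (Suc (Suc n)) k"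
          unfolding yS using x P(1) yX by (intro mult_le2) auto
        ultimately show ?thesis using le_trans zX yX by blast
      qed
      then show ?thesis using z zX by (auto simp: is_inf_def)
    qed
    show inc: "z i \<sqsubseteq> z j" if "i \<le> j" for i j
      using that by (induction rule: dec_induct) (use zX zS le_refl le_trans in blast)+
    show "\<exists>p\<in>P k. z n \<sqsubseteq> p" for n k
    proof (intro bexI)
      \<comment> \<open>This is the single point \<open>x (Suc (max n k))\<close>, far enough along
        to lie in \<open>P k\<close> and to be above \<open>z (max n k)\<close>, hence above
        \<open>z n\<close>.\<close>
      let ?p = "y (Suc (max n k)) 0"
      have "z (max n k) \<sqsubseteq> ?p" using z by (auto simp: is_inf_def)
      then show "z n \<sqsubseteq> ?p" using inc[of n "max n k"] le_trans zX yX by (meson max.cobounded1)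
      have "P j \<subseteq> P i" if "i \<le> j" for i j
        using that by (induction rule: dec_induct) (use anti in auto)
      then show "?p \<in> P k" using yP[of "max n k" 0] by (metis max.cobounded2 subsetD)
    qed
  qed
qed

end

subsection \<open>Completeness\<close>

context hausdorff_semilattice
begin

lemma is_inf_unique: "is_inf X m A x \<Longrightarrow> is_inf X m A y \<Longrightarrow> x = y"
  unfolding is_inf_def by (blast intro: le_antisym)

lemma is_sup_unique: "is_sup X m A x \<Longrightarrow> is_sup X m A y \<Longrightarrow> x = y"
  unfolding is_sup_def by (blast intro: le_antisym)

lemma subset_up_set: "A \<subseteq> topspace X \<Longrightarrow> A \<subseteq> up_set X m A"
  by (auto simp: up_set_def intro: le_refl)

lemma up_set_up_set:
  assumes "A \<subseteq> topspace X" shows "up_set X m A = up_set X m (up_set X m A)"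
proof
  show "up_set X m A \<subseteq> up_set X m (up_set X m A)" by (rule subset_up_set) (auto simp: up_set_def)
  show "up_set X m (up_set X m A) \<subseteq> up_set X m A"
    using assms unfolding up_set_def by (auto intro: le_trans)
qed

lemma upperD: "F = up_set X m F \<Longrightarrow> x \<in> F \<Longrightarrow> y \<in> topspace X \<Longrightarrow> x \<sqsubseteq> y \<Longrightarrow> y \<in> F"
  by (auto simp: up_set_def)

lemma upperI:
  assumes "F \<subseteq> topspace X" "\<And>x y. x \<in> F \<Longrightarrow> y \<in> topspace X \<Longrightarrow> x \<sqsubseteq> y \<Longrightarrow> y \<in> F"
  shows "F = up_set X m F"
proof
  show "F \<subseteq> up_set X m F" by (rule subset_up_set) (rule assms)
  show "up_set X m F \<subseteq> F" using assms(2) by (auto simp: up_set_def)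
qed

lemma up_set_mono: "A \<subseteq> B \<Longrightarrow> up_set X m A \<subseteq> up_set X m B"
  by (auto simp: up_set_def)

lemma down_set_mono: "A \<subseteq> B \<Longrightarrow> down_set X m A \<subseteq> down_set X m B"
  by (auto simp: down_set_def)

lemma up_set_mult:
  assumes "\<And>a b. a \<in> A \<Longrightarrow> b \<in> A \<Longrightarrow> m a b \<in> B" "A \<subseteq> topspace X"
    "x \<in> up_set X m A" "y \<in> up_set X m A"
  shows "m x y \<in> up_set X m B"
proof -
  obtain a b where "a \<in> A" "b \<in> A" "a \<sqsubseteq> x" "b \<sqsubseteq> y" "x \<in> topspace X" "y \<in> topspace X"
    using assms(3,4) by (auto simp: up_set_def)
  then show ?thesis
    using assms(1,2) closed mult_mono[of a x b y] unfolding up_set_def by blast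
qed

text \<open>For a neighbourhood \<open>T\<close> of \<open>y\<close>, the lower set of
  \<open>T\<close> is an open neighbourhood of \<open>x\<close>. It contains some \<open>a\<close>
  in \<open>A\<close> below some \<open>t\<close> in \<open>T\<close>, and \<open>t\<close> is in
  \<open>A\<close> because \<open>A\<close> is upper.\<close>

lemma down_open_closure_upper:
  assumes "down_open X m" "A \<subseteq> topspace X" "A = up_set X m A"
  shows "X closure_of A = up_set X m (X closure_of A)"
proof (rule upperI)
  fix x y assume x: "x \<in> X closure_of A" and y: "y \<in> topspace X" "x \<sqsubseteq> y"
  show "y \<in> X closure_of A" unfolding in_closure_of
  proof (intro conjI allI impI)
    fix T assume T: "y \<in> T \<and> openin X T"
    then have "openin X (down_set X m T)" using assms(1) by (simp add: down_open_def)
    moreover have "x \<in> down_set X m T" using x y T by (auto simp: down_set_def in_closure_of)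
    ultimately obtain a where a: "a \<in> A" "a \<in> down_set X m T" using x unfolding in_closure_of by blast
    then obtain t where "t \<in> T" "a \<sqsubseteq> t" by (auto simp: down_set_def)
    moreover have "t \<in> topspace X" using T \<open>t \<in> T\<close> openin_subset by blast
    ultimately show "\<exists>z. z \<in> A \<and> z \<in> T" using upperD[OF assms(3) a(1)] by blast
  qed (use y in auto)
qed (rule closure_of_subset_topspace)

lemma chain_subsemilattice: "sl_chain X m C \<Longrightarrow> subsemilattice X m C"
  unfolding sl_chain_def subsemilattice_def chain_def by (metis commute sl_le_def subsetD)

section \<open>Infima and suprema under c-completeness\<close>

lemma topspace_upper: "topspace X = up_set X m (topspace X)"
  by (rule upperI) auto

lemma c_complete_chain_inf:
  assumes "c_complete X m" "closedin X F" "F = up_set X m F" "sl_chain X m C" "C \<noteq> {}" "C \<subseteq> F"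
  obtains x where "is_inf X m C x" "x \<in> F"
  using assms unfolding c_complete_def by blast

lemma c_complete_chain_sup:
  assumes "c_complete X m" "sl_chain X m C" "C \<noteq> {}"
  obtains x where "is_sup X m C x" "x \<in> X closure_of (down_set X m C)"
proof -
  have "C \<subseteq> topspace X" using assms(2) by (simp add: sl_chain_def)
  then show thesis
    using that assms(2,3) topspace_upper assms(1)[unfolded c_complete_def, rule_format, of "topspace X" C]
    by auto
qed

text \<open>The completeness clause locates a supremum only in the closure of the lower set of the
  chain; a closed lower set containing the chain contains that closure.\<close>

lemma c_complete_sup_mem_lower:
  assumes "c_complete X m" "sl_chain X m C" "C \<noteq> {}" "is_sup X m C x"
    and L: "closedin X L" "\<And>u v. u \<in> L \<Longrightarrow> v \<in> topspace X \<Longrightarrow> v \<sqsubseteq> u \<Longrightarrow> v \<in> L" "C \<subseteq> L"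
  shows "x \<in> L"
proof -
  have "x \<in> X closure_of (down_set X m C)"
    using c_complete_chain_sup[OF assms(1-3)] is_sup_unique[OF assms(4)] by metis
  moreover have "down_set X m C \<subseteq> L" using L(2,3) by (auto simp: down_set_def)
  then have "X closure_of (down_set X m C) \<subseteq> L" using L(1) by (rule closure_of_minimal)
  ultimately show ?thesis by blast
qed

lemma c_complete_closed_upper_least:
  assumes "c_complete X m" "closedin X T" "T = up_set X m T" "subsemilattice X m T" "T \<noteq> {}"
  obtains w where "w \<in> T" "\<And>a. a \<in> T \<Longrightarrow> w \<sqsubseteq> a"
proof (rule obtain_least[OF assms(4,5)])
  fix C assume "sl_chain X m C" "C \<noteq> {}" "C \<subseteq> T"
  from c_complete_chain_inf[OF assms(1-3) this] show "\<exists>u\<in>T. \<forall>c\<in>C. u \<sqsubseteq> c"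
    unfolding is_inf_def by metis
qed (use that in blast)

text \<open>Zorn's lemma is applied to \<open>E\<close>, the points of \<open>F\<close> that remain
  in \<open>F\<close> after multiplication by any element of \<open>S\<close>. A minimal
  \<open>w\<close> in \<open>E\<close> is below every \<open>s\<close>, because \<open>m w s\<close>
  is again in \<open>E\<close> and below \<open>w\<close>.\<close>

lemma c_complete_lower_bound:
  assumes c: "c_complete X m" and F: "closedin X F" "F = up_set X m F"
    and S: "subsemilattice X m S" "S \<noteq> {}" "S \<subseteq> F"
  obtains w where "w \<in> F" "\<And>s. s \<in> S \<Longrightarrow> w \<sqsubseteq> s"
proof -
  have SX: "S \<subseteq> topspace X" and SS: "\<And>s t. s \<in> S \<Longrightarrow> t \<in> S \<Longrightarrow> m s t \<in> S"
    using S(1) by (auto simp: subsemilattice_def)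
  have FX: "F \<subseteq> topspace X" using F(1) by (rule closedin_subset)
  define E where "E = {x \<in> F. \<forall>s\<in>S. m x s \<in> F}"
  have "E \<noteq> {}" using S SS unfolding E_def by blast
  moreover have "\<exists>u\<in>E. \<forall>c\<in>C. u \<sqsubseteq> c" if C: "sl_chain X m C" "C \<noteq> {}" "C \<subseteq> E" for C
  proof -
    have CF: "C \<subseteq> F" using C by (auto simp: E_def)
    obtain u where u: "is_inf X m C u" "u \<in> F" using c_complete_chain_inf[OF c F C(1,2) CF] .
    have "m u s \<in> F" if s: "s \<in> S" for s
    proof -
      have sX: "s \<in> topspace X" and uX: "u \<in> topspace X" using s SX u(2) FX by auto
      have CX: "C \<subseteq> topspace X" using CF FX by blast
      \<comment> \<open>Multiplication by \<open>s\<close> is not known to commute with infima of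
        chains. It suffices that the infimum \<open>v\<close> of the translated chain lies in
        \<open>F\<close> and below \<open>m u s\<close>, since \<open>F\<close> is upper.\<close>
      let ?D = "(\<lambda>c. m c s) ` C"
      have "sl_chain X m ?D"
        using C(1) CX sX le_refl[OF sX] unfolding sl_chain_def chain_def
        by (auto intro: closed mult_mono) (meson mult_mono subsetD)
      moreover have "?D \<subseteq> F" using C(3) s by (auto simp: E_def)
      ultimately obtain v where v: "is_inf X m ?D v" "v \<in> F"
        using c_complete_chain_inf[OF c F, of ?D] C(2) by blast
      have vX: "v \<in> topspace X" using v(2) FX by auto
      have vc: "v \<sqsubseteq> m c s" "m c s \<in> topspace X" if "c \<in> C" for c
        using v(1) that CX sX by (auto simp: is_inf_def intro: closed)
      have "v \<sqsubseteq> c" if "c \<in> C" for c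
        using vc[OF that] that CX vX sX mult_le1 le_trans by (meson subsetD)
      then have "v \<sqsubseteq> u" using u(1) vX by (auto simp: is_inf_def)
      moreover obtain c where "c \<in> C" using C(2) by auto
      then have "v \<sqsubseteq> s" using vc CX vX sX mult_le2 le_trans by (meson subsetD)
      ultimately have "v \<sqsubseteq> m u s" using vX uX sX by (intro le_mult)
      then show ?thesis using upperD[OF F(2) v(2)] closed uX sX by blast
    qed
    then have "u \<in> E" using u(2) by (simp add: E_def)
    then show ?thesis using u(1) by (auto simp: is_inf_def)
  qed
  moreover have "E \<subseteq> topspace X" using FX by (auto simp: E_def)
  ultimately obtain w where w: "w \<in> E" "\<And>a. a \<in> E \<Longrightarrow> a \<sqsubseteq> w \<Longrightarrow> a = w"
    using obtain_minimal[of E] by metis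
  have wX: "w \<in> topspace X" and wF: "w \<in> F" using w(1) FX by (auto simp: E_def)
  have "w \<sqsubseteq> s" if s: "s \<in> S" for s
  proof -
    have sX: "s \<in> topspace X" using s SX by auto
    have "m (m w s) t \<in> F" if t: "t \<in> S" for t
    proof -
      have "m w (m s t) \<in> F" using w(1) SS[OF s t] by (auto simp: E_def)
      then show ?thesis using assoc[OF wX sX, of t] t SX by auto
    qed
    then have "m w s \<in> E" using w(1) s by (auto simp: E_def)
    then have "m w s = w" using w(2) mult_le1[OF wX sX] by blast
    then show ?thesis by (simp add: sl_le_def)
  qed
  with wF that show thesis by blast
qed

text \<open>A maximal lower bound is the greatest one, because two lower bounds have a join: their common
  upper bounds form a closed upper subsemilattice, which has a least element.\<close>

lemma c_complete_subsemilattice_inf: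
  assumes c: "c_complete X m" and F: "closedin X F" "F = up_set X m F"
    and S: "subsemilattice X m S" "S \<noteq> {}" "S \<subseteq> F"
  obtains x where "is_inf X m S x" "x \<in> F"
proof -
  have SX: "S \<subseteq> topspace X" using S(1) by (auto simp: subsemilattice_def)
  define B where "B = {x \<in> topspace X. \<forall>s\<in>S. x \<sqsubseteq> s}"
  have BX: "B \<subseteq> topspace X" by (auto simp: B_def)
  obtain b where b: "b \<in> F" "\<And>s. s \<in> S \<Longrightarrow> b \<sqsubseteq> s"
    using c_complete_lower_bound[OF c F S] by blast
  then have bB: "b \<in> B" using closedin_subset[OF F(1)] by (auto simp: B_def)
  have "\<exists>u\<in>B. \<forall>x\<in>C. x \<sqsubseteq> u" if C: "sl_chain X m C" "C \<noteq> {}" "C \<subseteq> B" for C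
  proof -
    obtain u where u: "is_sup X m C u" using c_complete_chain_sup[OF c C(1,2)] .
    then have "u \<in> B" using C(3) SX unfolding is_sup_def B_def by blast
    with u show ?thesis by (auto simp: is_sup_def)
  qed
  then obtain w where w: "w \<in> B" "\<And>a. a \<in> B \<Longrightarrow> w \<sqsubseteq> a \<Longrightarrow> a = w"
    using obtain_maximal[of B] BX bB by (metis empty_iff)
  have greatest: "a \<sqsubseteq> w" if a: "a \<in> B" for a
  proof -
    have aX: "a \<in> topspace X" and wX: "w \<in> topspace X" using a w(1) BX by auto
    define T where "T = {x \<in> topspace X. a \<sqsubseteq> x} \<inter> {x \<in> topspace X. w \<sqsubseteq> x}"
    have ST: "S \<subseteq> T" using a w(1) SX by (auto simp: T_def B_def)
    have "T = up_set X m T"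
      by (rule upperI) (auto simp: T_def intro: le_trans aX wX)
    moreover have "subsemilattice X m T"
      using aX wX unfolding subsemilattice_def T_def by (auto intro: closed le_mult)
    moreover have "closedin X T"
      unfolding T_def by (intro closedin_Int closedin_up aX wX)
    ultimately obtain j where j: "j \<in> T" "\<And>t. t \<in> T \<Longrightarrow> j \<sqsubseteq> t"
      using c_complete_closed_upper_least[OF c, of T] ST S(2) by blast
    \<comment> \<open>Elements of \<open>S\<close> are common upper bounds of \<open>a\<close> and
      \<open>w\<close>, so the join \<open>j\<close> is below all of them; maximality of
      \<open>w\<close> then gives \<open>j = w\<close>.\<close>
    then have "j \<in> B" using ST by (auto simp: B_def T_def)
    then show ?thesis using w(2)[of j] j(1) by (auto simp: T_def)
  qed
  have "is_inf X m S w" using w(1) greatest by (auto simp: is_inf_def B_def)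
  moreover have "w \<in> F" using upperD[OF F(2) b(1)] greatest[OF bB] w(1) BX by blast
  ultimately show thesis using that by blast
qed

section \<open>s-completeness and k-completeness\<close>

lemma s_complete_inf_mem_closure:
  assumes "s_complete X m" "subsemilattice X m S" "S \<noteq> {}" "is_inf X m S x"
  shows "x \<in> X closure_of (up_set X m S)"
proof -
  obtain y where "is_inf X m S y" "y \<in> X closure_of (up_set X m S)"
    using assms(1-3) unfolding s_complete_def by blast
  with is_inf_unique[OF assms(4)] show ?thesis by blast
qed

text \<open>Chains are subsemilattices, and a closed upper set containing a chain contains the
  closure of its upper set, where s-completeness places the infimum.\<close>

lemma s_complete_imp_c_complete:
  assumes s: "s_complete X m" shows "c_complete X m"
  unfolding c_complete_def
proof (intro allI impI)
  fix F C assume F: "closedin X F \<and> F = up_set X m F" and C: "sl_chain X m C \<and> C \<noteq> {} \<and> C \<subseteq> F"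
  obtain x where x: "is_inf X m C x" "x \<in> X closure_of (up_set X m C)"
    using s C chain_subsemilattice unfolding s_complete_def by metis
  have "up_set X m C \<subseteq> F" using F C up_set_mono by metis
  then have "x \<in> F" using x(2) F closure_of_minimal by blast
  moreover have "\<exists>x. is_sup X m C x \<and> x \<in> X closure_of (down_set X m C)"
    using s C unfolding s_complete_def by blast
  ultimately show "(\<exists>x. is_inf X m C x \<and> x \<in> F) \<and>
      (\<exists>x. is_sup X m C x \<and> x \<in> X closure_of (down_set X m C))"
    using x(1) by blast
qed

lemma k_complete_inf:
  assumes "k_complete X m" "closedin X K" "sl_chain X m C" "C \<noteq> {}" "C \<subseteq> K" "is_inf X m C x"
  shows "x \<in> K"
proof -
  obtain y where "is_inf X m C y" "y \<in> X closure_of C"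
    using assms(1,3,4) unfolding k_complete_def by blast
  then show ?thesis using is_inf_unique[OF assms(6)] closure_of_minimal[OF assms(5,2)] by blast
qed

lemma k_complete_sup:
  assumes "k_complete X m" "closedin X K" "sl_chain X m C" "C \<noteq> {}" "C \<subseteq> K" "is_sup X m C x"
  shows "x \<in> K"
proof -
  obtain y where "is_sup X m C y" "y \<in> X closure_of C"
    using assms(1,3,4) unfolding k_complete_def by blast
  then show ?thesis using is_sup_unique[OF assms(6)] closure_of_minimal[OF assms(5,2)] by blast
qed

lemma k_complete_least:
  assumes k: "k_complete X m" and S: "closedin X S" "subsemilattice X m S" "S \<noteq> {}"
  obtains w where "w \<in> S" "\<And>a. a \<in> S \<Longrightarrow> w \<sqsubseteq> a"
proof (rule obtain_least[OF S(2,3)])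
  fix C assume C: "sl_chain X m C" "C \<noteq> {}" "C \<subseteq> S"
  obtain u where u: "is_inf X m C u" using k C unfolding k_complete_def by blast
  with k_complete_inf[OF k S(1) C u] show "\<exists>u\<in>S. \<forall>c\<in>C. u \<sqsubseteq> c" by (auto simp: is_inf_def)
qed (use that in blast)

text \<open>Idempotence makes such a sequence decreasing, and the index shift makes intersections
  along it closed under products, which one neighbourhood alone does not ensure. Termwise
  intersections are again such sequences, so the sets built from them form filtered
  families.\<close>

definition nbhd_seq :: "'a \<Rightarrow> (nat \<Rightarrow> 'a set) \<Rightarrow> bool" where
  "nbhd_seq y U \<longleftrightarrow> (\<forall>i. openin X (U i) \<and> y \<in> U i \<and> (\<forall>a\<in>U (Suc i). \<forall>b\<in>U (Suc i). m a b \<in> U i))"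

lemma nbhd_seq_exists:
  assumes "openin X W" "y \<in> W"
  obtains U where "nbhd_seq y U" "U 0 = W"
proof -
  \<comment> \<open>The clause for \<open>i = 0\<close> pins the first term to \<open>W\<close>.
    Later terms come from continuity of the product at \<open>(y, y)\<close>, since
    \<open>m y y = y\<close>.\<close>
  let ?P = "\<lambda>i V. openin X V \<and> y \<in> V \<and> (i = (0::nat) \<longrightarrow> V = W)"
  have "\<exists>U. \<forall>i. ?P i (U i) \<and> (\<forall>a\<in>U (Suc i). \<forall>b\<in>U (Suc i). m a b \<in> U i)"
  proof (rule dependent_nat_choice)
    show "\<exists>V. ?P 0 V" using assms by blast
    fix V i assume V: "?P i V"
    then have y: "y \<in> topspace X" using openin_subset by blast
    then have "m y y \<in> V" using V idem by simp
    from mult_nhds[OF y y _ this] V obtain A B where AB: "openin X A" "openin X B" "y \<in> A" "y \<in> B"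
      "\<And>a b. a \<in> A \<Longrightarrow> b \<in> B \<Longrightarrow> m a b \<in> V" by metis
    then have "?P (Suc i) (A \<inter> B) \<and> (\<forall>a\<in>A \<inter> B. \<forall>b\<in>A \<inter> B. m a b \<in> V)" by auto
    then show "\<exists>V'. ?P (Suc i) V' \<and> (\<forall>a\<in>V'. \<forall>b\<in>V'. m a b \<in> V)" by blast
  qed
  then show thesis using that unfolding nbhd_seq_def by metis
qed

lemma nbhd_seq_Int: "nbhd_seq y U \<Longrightarrow> nbhd_seq y V \<Longrightarrow> nbhd_seq y (\<lambda>i. U i \<inter> V i)"
  by (auto simp: nbhd_seq_def)

end

subsection \<open>Images under continuous homomorphisms\<close>

locale hausdorff_semilattice_hom =
  X: hausdorff_semilattice X m + Y: hausdorff_semilattice Y n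
  for X :: "'a topology" and m and Y :: "'b topology" and n +
  fixes h :: "'a \<Rightarrow> 'b"
  assumes hom: "continuous_hom X m Y n h"
begin

lemma continuous_h: "continuous_map X Y h"
  using hom by (simp add: continuous_hom_def)

lemma h_mem: "x \<in> topspace X \<Longrightarrow> h x \<in> topspace Y"
  using continuous_h continuous_map_image_subset_topspace by blast

lemma h_mult: "x \<in> topspace X \<Longrightarrow> x' \<in> topspace X \<Longrightarrow> h (m x x') = n (h x) (h x')"
  using hom by (simp add: continuous_hom_def)

lemma h_mono: "x \<in> topspace X \<Longrightarrow> x' \<in> topspace X \<Longrightarrow> sl_le m x x' \<Longrightarrow> sl_le n (h x) (h x')"
  unfolding sl_le_def by (metis h_mult)

lemma h_closure:
  assumes "x \<in> X closure_of A" "\<And>a. a \<in> A \<Longrightarrow> a \<in> topspace X \<Longrightarrow> h a \<in> B"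
  shows "h x \<in> Y closure_of B"
proof -
  \<comment> \<open>\<open>A\<close> may leave the carrier; only its part inside the carrier affects
    the closure.\<close>
  have "x \<in> X closure_of (topspace X \<inter> A)" using assms(1) by (simp flip: closure_of_restrict)
  moreover have "topspace X \<inter> A \<subseteq> {a \<in> topspace X. h a \<in> B}" using assms(2) by auto
  ultimately have "x \<in> X closure_of {a \<in> topspace X. h a \<in> B}" using closure_of_mono by blast
  then show ?thesis using continuous_map_closure_preimage_subset[OF continuous_h] by blast
qed

lemma vimage_nonempty:
  assumes "y \<in> Y closure_of (h ` topspace X)" "openin Y W" "y \<in> W"
  shows "{x \<in> topspace X. h x \<in> W} \<noteq> {}"
  using assms unfolding in_closure_of by blast

lemma vimage_upper:
  assumes "A \<subseteq> topspace Y" "A = up_set Y n A"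
  shows "{x \<in> topspace X. h x \<in> A} = up_set X m {x \<in> topspace X. h x \<in> A}"
proof (rule X.upperI)
  fix x x' assume "x \<in> {x \<in> topspace X. h x \<in> A}" "x' \<in> topspace X" "sl_le m x x'"
  then show "x' \<in> {x \<in> topspace X. h x \<in> A}"
    using Y.upperD[OF assms(2), of "h x" "h x'"] h_mono h_mem by blast
qed auto

section \<open>Images of k-complete semilattices\<close>

lemma k_complete_image_mem:
  assumes k: "k_complete X m" and y: "y \<in> Y closure_of (h ` topspace X)"
  shows "y \<in> h ` topspace X"
proof -
  have yY: "y \<in> topspace Y" using y by (simp add: in_closure_of)
  define F where "F W = {x \<in> topspace X. h x \<in> Y closure_of W}" for W
  define K where "K U = (\<Inter>i::nat. F (U i))" for U
  have F_closed: "closedin X (F W)" for W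
    unfolding F_def by (rule closedin_continuous_map_preimage[OF continuous_h]) simp
  then have K_closed: "closedin X (K U)" for U
    unfolding K_def by blast
  have K_sub: "subsemilattice X m (K U)" if U: "Y.nbhd_seq y U" for U
    unfolding subsemilattice_def
  proof (intro conjI ballI)
    show "K U \<subseteq> topspace X" by (auto simp: K_def F_def)
    fix x x' assume x: "x \<in> K U" "x' \<in> K U"
    then have xX: "x \<in> topspace X" "x' \<in> topspace X" by (auto simp: K_def F_def)
    have "n (h x) (h x') \<in> Y closure_of (U i)" for i
      by (rule Y.closure_mult[of _ "U (Suc i)" _ "U (Suc i)"])
        (use x U in \<open>auto simp: K_def F_def Y.nbhd_seq_def\<close>)
    then show "m x x' \<in> K U" using xX X.closed h_mult by (auto simp: K_def F_def)
  qed
  have K_ne: "K U \<noteq> {}" if U: "Y.nbhd_seq y U" for U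
  proof -
    have "\<exists>z. (\<forall>i. z i \<in> topspace X) \<and> (\<forall>i. z i \<in> F (U i)) \<and> (\<forall>i j. i \<le> j \<longrightarrow> sl_le m (z i) (z j))"
    proof (rule X.obtain_increasing_infs[of "\<lambda>i. {x \<in> topspace X. h x \<in> U i}" "\<lambda>i. F (U i)"])
      show "{x \<in> topspace X. h x \<in> U i} \<noteq> {}" for i
        using vimage_nonempty[OF y] U by (auto simp: Y.nbhd_seq_def)
      show "m a b \<in> {x \<in> topspace X. h x \<in> U i}"
        if "a \<in> {x \<in> topspace X. h x \<in> U (Suc i)}" "b \<in> {x \<in> topspace X. h x \<in> U (Suc i)}" for i a b
        using that U by (auto simp: Y.nbhd_seq_def h_mult intro: X.closed)
      show "\<exists>x. is_inf X m C x" if "sl_chain X m C" "C \<noteq> {}" for C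
        using k that unfolding k_complete_def by blast
      show "x \<in> F (U i)" if C: "sl_chain X m C" "C \<noteq> {}" "C \<subseteq> {x \<in> topspace X. h x \<in> U i}"
        and x: "is_inf X m C x" for i C x
      proof (rule X.k_complete_inf[OF k F_closed C(1,2) _ x])
        have "U i \<subseteq> Y closure_of (U i)"
          using U by (intro closure_of_subset) (auto simp: Y.nbhd_seq_def openin_subset)
        then show "C \<subseteq> F (U i)" using C(3) by (auto simp: F_def)
      qed
    qed auto
    then obtain z where z: "\<And>i. z i \<in> topspace X" "\<And>i. z i \<in> F (U i)"
      "\<And>i j. i \<le> j \<Longrightarrow> sl_le m (z i) (z j)" by blast
    have ch: "sl_chain X m (z ` {i..})" for i
      unfolding sl_chain_def chain_def using z by (auto) (meson nat_le_linear)
    obtain s where s: "is_sup X m (range z) s"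
      using k ch[of 0] unfolding k_complete_def by (metis atLeast_0 empty_not_UNIV image_is_empty)
    \<comment> \<open>Every tail of an increasing sequence has the same supremum. The tail from
      \<open>i\<close> on lies in the closed set \<open>F (U i)\<close>, so \<open>s\<close> lies in
      \<open>F (U i)\<close> for each \<open>i\<close>.\<close>
    have tail: "is_sup X m (z ` {i..}) s" for i
      unfolding is_sup_def
    proof (intro conjI ballI impI)
      fix x assume x: "x \<in> topspace X" "\<forall>a\<in>z ` {i..}. sl_le m a x"
      have "sl_le m (z j) x" for j
        using x z(3)[of j "max i j"] X.le_trans[of "z j" "z (max i j)" x] z(1) by auto
      then show "sl_le m s x" using s x(1) by (auto simp: is_sup_def)
    qed (use s in \<open>auto simp: is_sup_def\<close>)
    have F_anti: "F (U j) \<subseteq> F (U i)" if "i \<le> j" for i j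
      using that
    proof (induction rule: dec_induct)
      case (step k)
      have "U (Suc k) \<subseteq> U k"
      proof
        fix a assume a: "a \<in> U (Suc k)"
        then have "a \<in> topspace Y" using U openin_subset unfolding Y.nbhd_seq_def by blast
        moreover have "n a a \<in> U k" using U a by (auto simp: Y.nbhd_seq_def)
        ultimately show "a \<in> U k" by (simp add: Y.idem)
      qed
      then have "F (U (Suc k)) \<subseteq> F (U k)" using closure_of_mono[of _ _ Y] by (auto simp: F_def)
      with step.IH show ?case by blast
    qed simp
    have "s \<in> F (U i)" for i
      by (rule X.k_complete_sup[OF k F_closed ch _ _ tail]) (use z(2) F_anti in auto)
    then show ?thesis by (auto simp: K_def)
  qed
  have top: "closedin X (topspace X)" "subsemilattice X m (topspace X)"
    by (auto simp: subsemilattice_def intro: X.closed)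
  have "\<Inter>{K U |U. Y.nbhd_seq y U} \<noteq> {}"
  proof -
    have "topspace X \<noteq> {}" using vimage_nonempty[OF y openin_topspace yY] by auto
    then obtain b where b: "b \<in> topspace X" "\<And>x. x \<in> topspace X \<Longrightarrow> sl_le m b x"
      using X.k_complete_least[OF k top] by blast
    obtain V where V: "Y.nbhd_seq y V" using Y.nbhd_seq_exists[OF openin_topspace yY] .
    show ?thesis
    proof (rule X.Inter_filtered_nonempty[OF b])
      show "\<exists>x. is_sup X m C x" if "sl_chain X m C" "C \<noteq> {}" for C
        using k that unfolding k_complete_def by blast
      show "{K U |U. Y.nbhd_seq y U} \<noteq> {}" using V by blast
      show "L \<noteq> {} \<and> L \<subseteq> topspace X" if "L \<in> {K U |U. Y.nbhd_seq y U}" for L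
        using that K_ne K_sub by (auto simp: subsemilattice_def)
      show "\<exists>N\<in>{K U |U. Y.nbhd_seq y U}. N \<subseteq> L \<inter> M"
        if LM: "L \<in> {K U |U. Y.nbhd_seq y U}" "M \<in> {K U |U. Y.nbhd_seq y U}" for L M
      proof -
        obtain U V where UV: "L = K U" "M = K V" "Y.nbhd_seq y U" "Y.nbhd_seq y V" using LM by blast
        have "F (A \<inter> B) \<subseteq> F A \<inter> F B" for A B
          using closure_of_mono[of "A \<inter> B" A Y] closure_of_mono[of "A \<inter> B" B Y] by (auto simp: F_def)
        then have "K (\<lambda>i. U i \<inter> V i) \<subseteq> K U \<inter> K V" unfolding K_def by blast
        then show ?thesis using Y.nbhd_seq_Int[OF UV(3,4)] UV(1,2) by blast
      qed
      show "\<exists>z\<in>L. sl_le m x z \<and> (\<forall>w\<in>L. sl_le m x w \<longrightarrow> sl_le m z w)"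
        if L: "L \<in> {K U |U. Y.nbhd_seq y U}" and x: "x \<in> topspace X" and ex: "\<exists>z\<in>L. sl_le m x z" for L x
      proof -
        have L': "closedin X L" "subsemilattice X m L" using L K_closed K_sub by auto
        \<comment> \<open>The part of \<open>L\<close> above \<open>x\<close> is again a closed
          subsemilattice, so k-completeness gives it a least element.\<close>
        let ?T = "L \<inter> {z \<in> topspace X. sl_le m x z}"
        have "closedin X ?T" using L'(1) x X.closedin_up by (intro closedin_Int)
        moreover have "subsemilattice X m ?T"
          using L'(2) x X.le_mult by (auto simp: subsemilattice_def intro: X.closed)
        moreover have "?T \<noteq> {}" using ex L'(1) closedin_subset by blast
        ultimately obtain z where "z \<in> ?T" "\<And>a. a \<in> ?T \<Longrightarrow> sl_le m z a"
          using X.k_complete_least[OF k, of ?T] by metis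
        then show ?thesis using closedin_subset[OF L'(1)] by blast
      qed
      show "x \<in> L" if L: "L \<in> {K U |U. Y.nbhd_seq y U}" and C: "sl_chain X m C" "C \<noteq> {}" "C \<subseteq> L"
        "is_sup X m C x" for L C x
        using X.k_complete_sup[OF k _ C] L K_closed by blast
    qed
  qed
  then obtain x where x: "\<And>U. Y.nbhd_seq y U \<Longrightarrow> x \<in> K U" by blast
  obtain V where "Y.nbhd_seq y V" using Y.nbhd_seq_exists[OF openin_topspace yY] .
  then have xX: "x \<in> topspace X" using x[of V] by (auto simp: K_def F_def)
  have "h x = y"
  proof (rule ccontr)
    assume "h x \<noteq> y"
    then obtain P Q where PQ: "openin Y P" "openin Y Q" "h x \<in> P" "y \<in> Q" "disjnt P Q"
      using Y.hausdorff h_mem[OF xX] yY unfolding Hausdorff_space_def by meson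
    \<comment> \<open>Starting the sequence at \<open>Q\<close> forces \<open>h x\<close> into the
      closure of \<open>Q\<close>, although the open set \<open>P\<close> around \<open>h x\<close>
      misses \<open>Q\<close>.\<close>
    obtain U where "Y.nbhd_seq y U" "U 0 = Q" using Y.nbhd_seq_exists[OF PQ(2,4)] .
    then have "h x \<in> Y closure_of Q" using x[of U] by (auto simp: K_def F_def)
    then show False using PQ unfolding in_closure_of disjnt_iff by blast
  qed
  with xX show ?thesis by blast
qed

text \<open>\<open>G1 W\<close> and \<open>G2 W\<close> are one-step and two-step approximations of the preimage of \<open>W\<close>. For a sequence
  \<open>U\<close> of neighbourhoods of \<open>y\<close>, the infimum of \<open>\<Inter>i. G1 (U i)\<close> is mapped below \<open>y\<close>; a common
  upper bound of these infima that is still mapped below \<open>y\<close> is mapped to \<open>y\<close>.\<close>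

lemma c_complete_image_mem:
  assumes c: "c_complete X m" and y: "y \<in> Y closure_of (h ` topspace X)"
    and G1_inf: "\<And>W C x. openin Y W \<Longrightarrow> y \<in> W \<Longrightarrow> sl_chain X m C \<Longrightarrow> C \<noteq> {} \<Longrightarrow>
      C \<subseteq> {x \<in> topspace X. h x \<in> W} \<Longrightarrow> is_inf X m C x \<Longrightarrow> x \<in> G1 W"
    and G1_upper: "\<And>W. openin Y W \<Longrightarrow> y \<in> W \<Longrightarrow> G1 W = up_set X m (G1 W)"
    and G1_mult: "\<And>W V x x'. openin Y W \<Longrightarrow> y \<in> W \<Longrightarrow> openin Y V \<Longrightarrow> y \<in> V \<Longrightarrow>
      (\<forall>a\<in>V. \<forall>b\<in>V. n a b \<in> W) \<Longrightarrow> x \<in> G1 V \<Longrightarrow> x' \<in> G1 V \<Longrightarrow> m x x' \<in> G1 W"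
    and G1_mono: "\<And>W V. V \<subseteq> W \<Longrightarrow> G1 V \<subseteq> G1 W"
    and G2_inf: "\<And>W S x. openin Y W \<Longrightarrow> y \<in> W \<Longrightarrow> subsemilattice X m S \<Longrightarrow> S \<noteq> {} \<Longrightarrow>
      S \<subseteq> G1 W \<Longrightarrow> is_inf X m S x \<Longrightarrow> x \<in> G2 W"
    and G2_separates: "\<And>x. x \<in> topspace X \<Longrightarrow> sl_le n (h x) y \<Longrightarrow>
      (\<And>W. openin Y W \<Longrightarrow> y \<in> W \<Longrightarrow> \<exists>w\<in>G2 W. w \<in> topspace X \<and> sl_le m w x) \<Longrightarrow> h x = y"
  shows "y \<in> h ` topspace X"
proof -
  have yY: "y \<in> topspace Y" using y by (simp add: in_closure_of)
  have U_nbhd: "openin Y (U i)" "y \<in> U i" if "Y.nbhd_seq y U" for U i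
    using that by (auto simp: Y.nbhd_seq_def)
  define S where "S U = {x \<in> topspace X. \<forall>i::nat. x \<in> G1 (U i)}" for U
  \<comment> \<open>The witness is the supremum of the increasing infima \<open>z i\<close>. It is
    above each of them, hence in every upper set \<open>G1 (U i)\<close>; each \<open>z i\<close> is
    also below points mapped into any \<open>U k\<close>, which bounds the image of the supremum
    from above.\<close>
  have S_point: "\<exists>x\<in>S U. \<forall>i. h x \<in> Y closure_of (down_set Y n (U i))" if U: "Y.nbhd_seq y U" for U
  proof -
    have "\<exists>z. (\<forall>i. z i \<in> topspace X) \<and> (\<forall>i. z i \<in> G1 (U i)) \<and> (\<forall>i j. i \<le> j \<longrightarrow> sl_le m (z i) (z j))
      \<and> (\<forall>i k. \<exists>p\<in>{x \<in> topspace X. h x \<in> U k}. sl_le m (z i) p)"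
    proof (rule X.obtain_increasing_infs[of "\<lambda>i. {x \<in> topspace X. h x \<in> U i}" "\<lambda>i. G1 (U i)"])
      show "{x \<in> topspace X. h x \<in> U i} \<noteq> {}" for i
        using vimage_nonempty[OF y] U by (auto simp: Y.nbhd_seq_def)
      show "m a b \<in> {x \<in> topspace X. h x \<in> U i}"
        if "a \<in> {x \<in> topspace X. h x \<in> U (Suc i)}" "b \<in> {x \<in> topspace X. h x \<in> U (Suc i)}" for i a b
        using that U by (auto simp: Y.nbhd_seq_def h_mult intro: X.closed)
      show "\<exists>x. is_inf X m C x" if C: "sl_chain X m C" "C \<noteq> {}" for C
      proof -
        have "C \<subseteq> topspace X" using C by (simp add: sl_chain_def)
        then show ?thesis
          using X.c_complete_chain_inf[OF c closedin_topspace X.topspace_upper C] by metis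
      qed
      show "x \<in> G1 (U i)" if "sl_chain X m C" "C \<noteq> {}" "C \<subseteq> {x \<in> topspace X. h x \<in> U i}"
        "is_inf X m C x" for i C x
        using G1_inf[OF U_nbhd[OF U] that] .
    qed (blast+)
    then obtain z where z: "\<And>i. z i \<in> topspace X" "\<And>i. z i \<in> G1 (U i)"
      "\<And>i j. i \<le> j \<Longrightarrow> sl_le m (z i) (z j)" "\<And>i k. \<exists>p\<in>{x \<in> topspace X. h x \<in> U k}. sl_le m (z i) p"
      by blast
    have ch: "sl_chain X m (range z)"
      unfolding sl_chain_def chain_def using z(1,3) by (auto) (meson nat_le_linear)
    obtain s where s: "is_sup X m (range z) s" "s \<in> X closure_of (down_set X m (range z))"
      using X.c_complete_chain_sup[OF c ch] by blast
    then have sX: "s \<in> topspace X" and zs: "\<And>i. sl_le m (z i) s" by (auto simp: is_sup_def)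
    have "s \<in> G1 (U i)" for i
      using X.upperD[OF G1_upper[OF U_nbhd[OF U]] z(2) sX zs] .
    then have "s \<in> S U" using sX by (simp add: S_def)
    moreover have "h s \<in> Y closure_of (down_set Y n (U k))" for k
    proof (rule h_closure[OF s(2)])
      fix a assume "a \<in> down_set X m (range z)" and aX: "a \<in> topspace X"
      then obtain i where i: "sl_le m a (z i)" by (auto simp: down_set_def)
      obtain p where p: "p \<in> topspace X" "h p \<in> U k" "sl_le m (z i) p" using z(4) by blast
      have "sl_le m a p" using X.le_trans[OF i p(3)] aX z(1) p(1) by blast
      then have "sl_le n (h a) (h p)" using h_mono aX p(1) by blast
      then show "h a \<in> down_set Y n (U k)" using p(2) h_mem[OF aX] by (auto simp: down_set_def)
    qed
    ultimately show ?thesis by blast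
  qed
  have S_sub: "subsemilattice X m (S U)" if U: "Y.nbhd_seq y U" for U
    unfolding subsemilattice_def
  proof (intro conjI ballI)
    show "S U \<subseteq> topspace X" by (auto simp: S_def)
    fix x x' assume x: "x \<in> S U" "x' \<in> S U"
    have "m x x' \<in> G1 (U i)" for i
      using G1_mult[of "U i" "U (Suc i)" x x'] U x by (auto simp: S_def Y.nbhd_seq_def)
    then show "m x x' \<in> S U" using x by (auto simp: S_def intro: X.closed)
  qed
  have S_Int: "S (\<lambda>i. U i \<inter> V i) \<subseteq> S U \<inter> S V" for U V
    using G1_mono[of "A \<inter> B" A for A B] G1_mono[of "A \<inter> B" B for A B] unfolding S_def by blast
  define z where "z U = (SOME x. is_inf X m (S U) x)" for U
  have z: "is_inf X m (S U) (z U)" if U: "Y.nbhd_seq y U" for U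
  proof -
    have "S U \<noteq> {}" "S U \<subseteq> topspace X" using S_point[OF U] by (auto simp: S_def)
    then have "\<exists>x. is_inf X m (S U) x"
      using X.c_complete_subsemilattice_inf[OF c closedin_topspace X.topspace_upper S_sub[OF U]]
      by metis
    then show ?thesis unfolding z_def by (rule someI_ex)
  qed
  have zX: "z U \<in> topspace X" if "Y.nbhd_seq y U" for U
    using z[OF that] by (simp add: is_inf_def)
  \<comment> \<open>Intersecting sequences shrinks \<open>S\<close>, so its infimum can only
    rise.\<close>
  have z_Int: "sl_le m (z U) (z (\<lambda>i. U i \<inter> V i))" "sl_le m (z V) (z (\<lambda>i. U i \<inter> V i))"
    if "Y.nbhd_seq y U" "Y.nbhd_seq y V" for U V
    using z[OF that(1)] z[OF that(2)] z[OF Y.nbhd_seq_Int[OF that]] S_Int[of U V]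
    unfolding is_inf_def by blast+
  \<comment> \<open>Given \<open>W\<close>, the point is taken from \<open>S\<close> of the sequence
    refined to begin inside \<open>W\<close>. It still belongs to \<open>S U\<close>, so it is above
    \<open>z U\<close>.\<close>
  have hz: "sl_le n (h (z U)) y" if U: "Y.nbhd_seq y U" for U
  proof (rule Y.le_of_le_closure_down)
    fix W assume W: "openin Y W" "y \<in> W"
    obtain V where V: "Y.nbhd_seq y V" "V 0 = W" using Y.nbhd_seq_exists[OF W] .
    obtain x where x: "x \<in> S (\<lambda>i. U i \<inter> V i)" "h x \<in> Y closure_of (down_set Y n (U 0 \<inter> V 0))"
      using S_point[OF Y.nbhd_seq_Int[OF U V(1)]] by blast
    have "Y closure_of (down_set Y n (U 0 \<inter> V 0)) \<subseteq> Y closure_of (down_set Y n W)"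
      using V(2) by (intro closure_of_mono Y.down_set_mono) auto
    moreover have "sl_le m (z U) x" using z[OF U] x(1) S_Int[of U V] by (auto simp: is_inf_def)
    then have "sl_le n (h (z U)) (h x)" using h_mono zX[OF U] x(1) by (simp add: S_def)
    ultimately show "\<exists>b\<in>Y closure_of (down_set Y n W). sl_le n (h (z U)) b" using x(2) by blast
  qed (use zX[OF U] h_mem yY in auto)
  define L where "L = {x \<in> topspace X. sl_le n (h x) y}"
  have L_closed: "closedin X L"
  proof -
    have "L = {x \<in> topspace X. h x \<in> {u \<in> topspace Y. sl_le n u y}}"
      using h_mem by (auto simp: L_def)
    then show ?thesis
      using closedin_continuous_map_preimage[OF continuous_h Y.closedin_down[OF yY]] by simp
  qed
  have L_lower: "v \<in> L" if "u \<in> L" "v \<in> topspace X" "sl_le m v u" for u v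
    using that h_mono h_mem yY Y.le_trans[of "h v" "h u" y] by (simp add: L_def)
  \<comment> \<open>\<open>L\<close> is a closed lower set: being lower keeps infima in it, and
    closedness as well keeps suprema of chains. \<open>K U\<close> contains \<open>z U\<close>,
    which makes it nonempty.\<close>
  define K where "K U = {x \<in> L. sl_le m (z U) x}" for U
  have KX: "K U \<subseteq> topspace X" for U by (auto simp: K_def L_def)
  have "\<Inter>{K U |U. Y.nbhd_seq y U} \<noteq> {}"
  proof -
    have ne: "topspace X \<noteq> {}" using vimage_nonempty[OF y openin_topspace yY] by auto
    have top: "subsemilattice X m (topspace X)" by (auto simp: subsemilattice_def intro: X.closed)
    obtain b where b: "b \<in> topspace X" "\<And>x. x \<in> topspace X \<Longrightarrow> sl_le m b x"
      using X.c_complete_closed_upper_least[OF c closedin_topspace X.topspace_upper top ne] by blast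
    obtain V where V: "Y.nbhd_seq y V" using Y.nbhd_seq_exists[OF openin_topspace yY] .
    show ?thesis
    proof (rule X.Inter_filtered_nonempty[OF b])
      show "\<exists>x. is_sup X m C x" if "sl_chain X m C" "C \<noteq> {}" for C
        using X.c_complete_chain_sup[OF c that] by metis
      show "{K U |U. Y.nbhd_seq y U} \<noteq> {}" using V by blast
      show "M \<noteq> {} \<and> M \<subseteq> topspace X" if M: "M \<in> {K U |U. Y.nbhd_seq y U}" for M
      proof -
        obtain U where U: "M = K U" "Y.nbhd_seq y U" using M by blast
        then have "z U \<in> M" using zX hz X.le_refl by (simp add: K_def L_def)
        then show ?thesis using U(1) KX by blast
      qed
      show "\<exists>N\<in>{K U |U. Y.nbhd_seq y U}. N \<subseteq> M \<inter> M'"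
        if MM: "M \<in> {K U |U. Y.nbhd_seq y U}" "M' \<in> {K U |U. Y.nbhd_seq y U}" for M M'
      proof -
        obtain U V where UV: "M = K U" "M' = K V" "Y.nbhd_seq y U" "Y.nbhd_seq y V" using MM by blast
        note UV' = Y.nbhd_seq_Int[OF UV(3,4)]
        have "K (\<lambda>i. U i \<inter> V i) \<subseteq> K U \<inter> K V"
        proof
          fix x assume x: "x \<in> K (\<lambda>i. U i \<inter> V i)"
          then have "x \<in> topspace X" using KX by blast
          then show "x \<in> K U \<inter> K V"
            using x X.le_trans[OF z_Int(1)[OF UV(3,4)], of x] X.le_trans[OF z_Int(2)[OF UV(3,4)], of x]
              zX[OF UV'] zX[OF UV(3)] zX[OF UV(4)] by (simp add: K_def)
        qed
        then show ?thesis using UV' UV(1,2) by blast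
      qed
      show "\<exists>w\<in>M. sl_le m x w \<and> (\<forall>w'\<in>M. sl_le m x w' \<longrightarrow> sl_le m w w')"
        if M: "M \<in> {K U |U. Y.nbhd_seq y U}" and x: "x \<in> topspace X" and ex: "\<exists>w\<in>M. sl_le m x w" for M x
      proof -
        obtain U where U: "M = K U" "Y.nbhd_seq y U" using M by blast
        let ?T = "{w \<in> M. sl_le m x w}"
        have TX: "?T \<subseteq> topspace X" using U KX by auto
        have mult: "m u v \<in> ?T" if u: "u \<in> ?T" and v: "v \<in> ?T" for u v
        proof -
          have uv: "u \<in> topspace X" "v \<in> topspace X" using u v TX by auto
          have "m u v \<in> L"
            using L_lower[of u "m u v"] u U(1) X.closed[OF uv] X.mult_le1[OF uv] by (simp add: K_def)
          moreover have "sl_le m (z U) (m u v)" "sl_le m x (m u v)"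
            using u v U(1) uv x zX[OF U(2)] by (auto intro!: X.le_mult simp: K_def)
          ultimately show ?thesis using U(1) by (simp add: K_def)
        qed
        then have "subsemilattice X m ?T" using TX by (auto simp: subsemilattice_def)
        then obtain w where w: "is_inf X m ?T w"
          using X.c_complete_subsemilattice_inf[OF c closedin_topspace X.topspace_upper, of ?T] TX ex
          by blast
        obtain t where t: "t \<in> ?T" using ex by blast
        \<comment> \<open>The infimum is formed in all of \<open>X\<close>. It lies in
          \<open>L\<close> because it is below \<open>t\<close>, and above \<open>z U\<close> and
          \<open>x\<close> because both are lower bounds of the set; so it is the least element
          sought.\<close>
        have "w \<in> L" using L_lower[of t w] t w U(1) by (auto simp: is_inf_def K_def)
        moreover have "sl_le m (z U) w" "sl_le m x w"
          using w zX[OF U(2)] x U(1) by (auto simp: is_inf_def K_def)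
        ultimately show ?thesis using w U(1) unfolding is_inf_def by (auto simp: K_def)
      qed
      show "x \<in> M" if M: "M \<in> {K U |U. Y.nbhd_seq y U}" and C: "sl_chain X m C" "C \<noteq> {}" "C \<subseteq> M"
        "is_sup X m C x" for M C x
      proof -
        obtain U where U: "M = K U" "Y.nbhd_seq y U" using M by blast
        have "C \<subseteq> L" using C(3) U(1) by (auto simp: K_def)
        then have "x \<in> L" using X.c_complete_sup_mem_lower[OF c C(1,2,4) L_closed] L_lower by blast
        moreover obtain a where a: "a \<in> C" using C(2) by blast
        then have "sl_le m (z U) a" "sl_le m a x" "a \<in> topspace X" "x \<in> topspace X"
          using C(3,4) U(1) KX by (auto simp: K_def is_sup_def)
        then have "sl_le m (z U) x" using X.le_trans zX[OF U(2)] by blast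
        ultimately show ?thesis using U(1) by (simp add: K_def)
      qed
    qed
  qed
  then obtain x where x: "\<And>U. Y.nbhd_seq y U \<Longrightarrow> x \<in> K U" by blast
  obtain V where "Y.nbhd_seq y V" using Y.nbhd_seq_exists[OF openin_topspace yY] .
  then have xL: "x \<in> topspace X" "sl_le n (h x) y" using x[of V] by (auto simp: K_def L_def)
  have "h x = y"
  proof (rule G2_separates[OF xL])
    fix W assume W: "openin Y W" "y \<in> W"
    obtain U where U: "Y.nbhd_seq y U" "U 0 = W" using Y.nbhd_seq_exists[OF W] .
    have "S U \<subseteq> G1 W" using U(2) by (auto simp: S_def)
    then have "z U \<in> G2 W"
      using G2_inf[OF W S_sub[OF U(1)] _ _ z[OF U(1)]] S_point[OF U(1)] by blast
    then show "\<exists>w\<in>G2 W. w \<in> topspace X \<and> sl_le m w x"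
      using x[OF U(1)] zX[OF U(1)] by (auto simp: K_def)
  qed
  with xL(1) show ?thesis by blast
qed

text \<open>Here each passage to an infimum costs a closure: infima of chains land in
  \<open>G1\<close>, infima of subsemilattices of \<open>G1\<close> land in \<open>G2\<close>.
  Comparison with \<open>x\<close> adds one more upper set, which yields exactly the nested
  expression in well-separatedness.\<close>

lemma s_complete_image_mem:
  assumes s: "s_complete X m" and sep: "well_separated Y n" and y: "y \<in> Y closure_of (h ` topspace X)"
  shows "y \<in> h ` topspace X"
proof -
  \<comment> \<open>The outer upper set is taken because the closure of an upper set is not known to
    be upper in \<open>Y\<close>.\<close>
  define D where "D W = up_set Y n (Y closure_of (up_set Y n W))" for W
  define G1 where "G1 W = {x \<in> topspace X. h x \<in> D W}" for W
  define G2 where "G2 W = {x \<in> topspace X. h x \<in> Y closure_of (D W)}" for W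
  have yY: "y \<in> topspace Y" using y by (simp add: in_closure_of)
  have D_top: "D W \<subseteq> topspace Y" for W by (auto simp: D_def up_set_def)
  have D_upper: "D W = up_set Y n (D W)" for W
    unfolding D_def by (rule Y.up_set_up_set) (rule closure_of_subset_topspace)
  have G1_upper: "G1 W = up_set X m (G1 W)" for W
    unfolding G1_def by (rule vimage_upper[OF D_top D_upper])
  show ?thesis
  proof (rule c_complete_image_mem[OF X.s_complete_imp_c_complete[OF s] y, of G1 G2])
    fix W C x assume C: "sl_chain X m C" "C \<noteq> {}" "C \<subseteq> {x \<in> topspace X. h x \<in> W}" "is_inf X m C x"
    have "x \<in> X closure_of (up_set X m C)"
      using X.s_complete_inf_mem_closure[OF s X.chain_subsemilattice C(2,4)] C(1) by blast
    then have "h x \<in> Y closure_of (up_set Y n W)"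
    proof (rule h_closure)
      fix a assume "a \<in> up_set X m C" "a \<in> topspace X"
      then show "h a \<in> up_set Y n W" using C(3) h_mono h_mem by (auto simp: up_set_def)
    qed
    then show "x \<in> G1 W"
      using Y.subset_up_set[OF closure_of_subset_topspace] C(4) by (auto simp: G1_def D_def is_inf_def)
  next
    fix W V x x' assume V: "openin Y V" "\<forall>a\<in>V. \<forall>b\<in>V. n a b \<in> W" and x: "x \<in> G1 V" "x' \<in> G1 V"
    have "n (h x) (h x') \<in> D W"
      unfolding D_def
    proof (rule Y.up_set_mult[where A = "Y closure_of (up_set Y n V)"])
      fix a b assume "a \<in> Y closure_of (up_set Y n V)" "b \<in> Y closure_of (up_set Y n V)"
      then show "n a b \<in> Y closure_of (up_set Y n W)"
        by (rule Y.closure_mult)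
          (use Y.up_set_mult[of V W] V openin_subset in blast)
    qed (use x closure_of_subset_topspace[of Y] in \<open>auto simp: G1_def D_def\<close>)
    then show "m x x' \<in> G1 W" using x X.closed h_mult by (auto simp: G1_def)
  next
    fix W V :: "'b set" assume "V \<subseteq> W"
    then have "D V \<subseteq> D W" unfolding D_def by (intro Y.up_set_mono closure_of_mono)
    then show "G1 V \<subseteq> G1 W" by (auto simp: G1_def)
  next
    fix W S x assume S: "subsemilattice X m S" "S \<noteq> {}" "S \<subseteq> G1 W" "is_inf X m S x"
    have "x \<in> X closure_of (up_set X m S)" using X.s_complete_inf_mem_closure[OF s S(1,2,4)] .
    moreover have "up_set X m S \<subseteq> G1 W" using X.up_set_mono[OF S(3)] G1_upper by simp
    ultimately have "h x \<in> Y closure_of (D W)" by (rule_tac h_closure) (auto simp: G1_def)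
    then show "x \<in> G2 W" using S(4) by (auto simp: G2_def is_inf_def)
  next
    fix x assume x: "x \<in> topspace X" "sl_le n (h x) y"
      and G2: "\<And>W. openin Y W \<Longrightarrow> y \<in> W \<Longrightarrow> \<exists>w\<in>G2 W. w \<in> topspace X \<and> sl_le m w x"
    show "h x = y"
    proof (rule ccontr)
      assume "h x \<noteq> y"
      then obtain V where V: "V \<subseteq> topspace Y" "y \<in> Y interior_of V"
        "h x \<notin> up_set Y n (Y closure_of (up_set Y n (Y closure_of up_set Y n V)))"
        using sep x h_mem yY unfolding well_separated_def by meson
      \<comment> \<open>The separating neighbourhood need not be open, so its interior is used and
        monotonicity of \<open>D\<close> leads back to \<open>V\<close>.\<close>
      obtain w where w: "w \<in> G2 (Y interior_of V)" "w \<in> topspace X" "sl_le m w x"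
        using G2[of "Y interior_of V"] V(2) by auto
      have "D (Y interior_of V) \<subseteq> D V"
        unfolding D_def by (intro Y.up_set_mono closure_of_mono interior_of_subset)
      then have "h w \<in> Y closure_of (D V)" using w(1) closure_of_mono[of _ _ Y] by (auto simp: G2_def)
      moreover have "sl_le n (h w) (h x)" using h_mono w(2,3) x(1) by blast
      ultimately show False using V(3) h_mem x(1) by (auto simp: up_set_def D_def)
    qed
  qed (rule G1_upper)
qed

text \<open>Common core of both down-open cases. Under c-completeness a closed upper set keeps the
  infima of its subsemilattices, so one family \<open>G\<close> serves for both approximation steps.
  The point \<open>x\<close> then lies in every \<open>G W\<close>, which gives \<open>y\<close>
  below \<open>h x\<close>.\<close>

lemma closed_upper_image_mem:
  assumes c: "c_complete X m" and y: "y \<in> Y closure_of (h ` topspace X)"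
    and G_closed: "\<And>W. openin Y W \<Longrightarrow> closedin X (G W)"
    and G_upper: "\<And>W. openin Y W \<Longrightarrow> G W = up_set X m (G W)"
    and G_vimage: "\<And>W. openin Y W \<Longrightarrow> {x \<in> topspace X. h x \<in> W} \<subseteq> G W"
    and G_mult: "\<And>W V x x'. openin Y W \<Longrightarrow> openin Y V \<Longrightarrow> (\<forall>a\<in>V. \<forall>b\<in>V. n a b \<in> W) \<Longrightarrow>
      x \<in> G V \<Longrightarrow> x' \<in> G V \<Longrightarrow> m x x' \<in> G W"
    and G_mono: "\<And>W V. V \<subseteq> W \<Longrightarrow> G V \<subseteq> G W"
    and G_up: "\<And>W x. openin Y W \<Longrightarrow> x \<in> G W \<Longrightarrow> h x \<in> Y closure_of (up_set Y n W)"
  shows "y \<in> h ` topspace X"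
proof -
  have yY: "y \<in> topspace Y" using y by (simp add: in_closure_of)
  have G_inf: "x \<in> G W"
    if W: "openin Y W" and S: "subsemilattice X m S" "S \<noteq> {}" "S \<subseteq> G W" and x: "is_inf X m S x" for W S x
    using X.c_complete_subsemilattice_inf[OF c G_closed[OF W] G_upper[OF W] S]
      X.is_inf_unique[OF x] by metis
  show ?thesis
  proof (rule c_complete_image_mem[OF c y, of G G])
    fix W C x assume W: "openin Y W"
      and C: "sl_chain X m C" "C \<noteq> {}" "C \<subseteq> {x \<in> topspace X. h x \<in> W}" "is_inf X m C x"
    show "x \<in> G W"
      using G_inf[OF W X.chain_subsemilattice[OF C(1)] C(2) _ C(4)] C(3) G_vimage[OF W] by blast
  next
    fix x assume x: "x \<in> topspace X" "sl_le n (h x) y"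
      and G: "\<And>W. openin Y W \<Longrightarrow> y \<in> W \<Longrightarrow> \<exists>w\<in>G W. w \<in> topspace X \<and> sl_le m w x"
    have "sl_le n y (h x)"
    proof (rule Y.le_of_in_closure_up[OF h_mem[OF x(1)] yY])
      fix W assume W: "openin Y W" "y \<in> W"
      then obtain w where "w \<in> G W" "sl_le m w x" using G by blast
      then have "x \<in> G W" using X.upperD[OF G_upper[OF W(1)]] x(1) by blast
      then show "h x \<in> Y closure_of (up_set Y n W)" using G_up W(1) by blast
    qed
    then show "h x = y" using Y.le_antisym x(2) h_mem[OF x(1)] yY by blast
  qed (rule G_upper G_mult G_mono G_inf, assumption+)+
qed

text \<open>Down-openness of \<open>Y\<close> keeps the closure of an upper set upper, so its
  preimage under \<open>h\<close> is a closed upper set in \<open>X\<close>.\<close>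

lemma c_complete_down_open_codomain_image_mem:
  assumes c: "c_complete X m" and d: "down_open Y n" and y: "y \<in> Y closure_of (h ` topspace X)"
  shows "y \<in> h ` topspace X"
proof (rule closed_upper_image_mem[OF c y, of "\<lambda>W. {x \<in> topspace X. h x \<in> Y closure_of (up_set Y n W)}"])
  fix W assume W: "openin Y W"
  then have WY: "W \<subseteq> topspace Y" by (rule openin_subset)
  have up: "up_set Y n W \<subseteq> topspace Y" by (auto simp: up_set_def)
  show "closedin X {x \<in> topspace X. h x \<in> Y closure_of (up_set Y n W)}"
    by (rule closedin_continuous_map_preimage[OF continuous_h]) simp
  show "{x \<in> topspace X. h x \<in> Y closure_of (up_set Y n W)} =
      up_set X m {x \<in> topspace X. h x \<in> Y closure_of (up_set Y n W)}"
    by (rule vimage_upper[OF closure_of_subset_topspace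
          Y.down_open_closure_upper[OF d up Y.up_set_up_set[OF WY]]])
  show "{x \<in> topspace X. h x \<in> W} \<subseteq> {x \<in> topspace X. h x \<in> Y closure_of (up_set Y n W)}"
    using Y.subset_up_set[OF WY] closure_of_subset[OF up] by blast
next
  fix W V x x' assume V: "openin Y V" "\<forall>a\<in>V. \<forall>b\<in>V. n a b \<in> W"
    and x: "x \<in> {x \<in> topspace X. h x \<in> Y closure_of (up_set Y n V)}"
      "x' \<in> {x \<in> topspace X. h x \<in> Y closure_of (up_set Y n V)}"
  have "n (h x) (h x') \<in> Y closure_of (up_set Y n W)"
    by (rule Y.closure_mult[of _ "up_set Y n V" _ "up_set Y n V"])
      (use x Y.up_set_mult[of V W] V openin_subset in blast)+
  then show "m x x' \<in> {x \<in> topspace X. h x \<in> Y closure_of (up_set Y n W)}"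
    using x X.closed h_mult by auto
next
  fix W V :: "'b set" assume "V \<subseteq> W"
  then have "Y closure_of (up_set Y n V) \<subseteq> Y closure_of (up_set Y n W)"
    by (intro closure_of_mono Y.up_set_mono)
  then show "{x \<in> topspace X. h x \<in> Y closure_of (up_set Y n V)} \<subseteq>
      {x \<in> topspace X. h x \<in> Y closure_of (up_set Y n W)}" by blast
qed auto

text \<open>With down-openness assumed of \<open>X\<close> instead, upper sets and closures are
  formed in \<open>X\<close> from the preimage of \<open>W\<close>; monotonicity and continuity of
  \<open>h\<close> carry the result into the closure of the upper set of \<open>W\<close>.\<close>

lemma c_complete_down_open_domain_image_mem:
  assumes c: "c_complete X m" and d: "down_open X m" and y: "y \<in> Y closure_of (h ` topspace X)"
  shows "y \<in> h ` topspace X"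
proof -
  define P where "P W = {x \<in> topspace X. h x \<in> W}" for W
  have PX: "P W \<subseteq> topspace X" for W by (auto simp: P_def)
  have up: "up_set X m (P W) \<subseteq> topspace X" for W by (auto simp: up_set_def)
  show ?thesis
  proof (rule closed_upper_image_mem[OF c y, of "\<lambda>W. X closure_of (up_set X m (P W))"])
    fix W
    show "X closure_of up_set X m (P W) = up_set X m (X closure_of up_set X m (P W))"
      by (rule X.down_open_closure_upper[OF d up X.up_set_up_set[OF PX]])
    show "{x \<in> topspace X. h x \<in> W} \<subseteq> X closure_of up_set X m (P W)"
      using X.subset_up_set[OF PX] closure_of_subset[OF up] unfolding P_def by blast
    fix x assume "x \<in> X closure_of up_set X m (P W)"
    then show "h x \<in> Y closure_of (up_set Y n W)"
    proof (rule h_closure)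
      fix a assume "a \<in> up_set X m (P W)" "a \<in> topspace X"
      then show "h a \<in> up_set Y n W" using h_mono h_mem by (auto simp: up_set_def P_def)
    qed
  next
    fix W V x x' assume V: "\<forall>a\<in>V. \<forall>b\<in>V. n a b \<in> W"
      and x: "x \<in> X closure_of up_set X m (P V)" "x' \<in> X closure_of up_set X m (P V)"
    have "m a b \<in> P W" if "a \<in> P V" "b \<in> P V" for a b
      using that V h_mult X.closed by (auto simp: P_def)
    then show "m x x' \<in> X closure_of up_set X m (P W)"
      using X.closure_mult[OF x] X.up_set_mult[of "P V" "P W"] PX by blast
  next
    fix W V :: "'b set" assume "V \<subseteq> W"
    then show "X closure_of up_set X m (P V) \<subseteq> X closure_of up_set X m (P W)"
      by (intro closure_of_mono X.up_set_mono) (auto simp: P_def)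
  qed auto
qed

end

section \<open>The four closedness statements, reduced to closure points of the image\<close>

theorem corollary9p2:
  fixes X :: "'a topology" and m :: "'a \<Rightarrow> 'a \<Rightarrow> 'a"
  assumes "topological_semilattice X m" and "Hausdorff_space X"
  shows
    "(k_complete X m \<longrightarrow>
       (\<forall>(Y :: 'b topology) n h.
          topological_semilattice Y n \<and> Hausdorff_space Y \<and> continuous_hom X m Y n h
          \<longrightarrow> closedin Y (h ` topspace X))) \<and>
     (s_complete X m \<longrightarrow>
       (\<forall>(Y :: 'b topology) n h.
          topological_semilattice Y n \<and> Hausdorff_space Y \<and> well_separated Y n \<and>
          continuous_hom X m Y n h
          \<longrightarrow> closedin Y (h ` topspace X))) \<and>
     (c_complete X m \<longrightarrow>
       (\<forall>(Y :: 'b topology) n h.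
          topological_semilattice Y n \<and> Hausdorff_space Y \<and> down_open Y n \<and>
          continuous_hom X m Y n h
          \<longrightarrow> closedin Y (h ` topspace X))) \<and>
     (c_complete X m \<and> down_open X m \<longrightarrow>
       (\<forall>(Y :: 'b topology) n h.
          topological_semilattice Y n \<and> Hausdorff_space Y \<and> continuous_hom X m Y n h
          \<longrightarrow> closedin Y (h ` topspace X)))"
proof -
  have loc: "hausdorff_semilattice_hom X m Y n h"
    if "topological_semilattice Y n" "Hausdorff_space Y" "continuous_hom X m Y n h"
    for Y :: "'b topology" and n h
    using assms that
    by (simp add: hausdorff_semilattice_hom_def hausdorff_semilattice_hom_axioms_def
        hausdorff_semilattice_def hausdorff_semilattice_axioms_def)
  have closed: "closedin Y (h ` topspace X)"
    if "continuous_hom X m Y n h" "\<And>y. y \<in> Y closure_of (h ` topspace X) \<Longrightarrow> y \<in> h ` topspace X"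
    for Y :: "'b topology" and n h
  proof -
    have "h ` topspace X \<subseteq> topspace Y"
      using that(1) continuous_map_image_subset_topspace[of X Y h] by (simp add: continuous_hom_def)
    with that(2) show ?thesis using closure_of_subset_eq by blast
  qed
  show ?thesis
  proof (intro conjI impI allI)
    fix Y :: "'b topology" and n h
    assume "k_complete X m"
      and "topological_semilattice Y n \<and> Hausdorff_space Y \<and> continuous_hom X m Y n h"
    then show "closedin Y (h ` topspace X)"
      using closed hausdorff_semilattice_hom.k_complete_image_mem[OF loc] by blast
  next
    fix Y :: "'b topology" and n h
    assume "s_complete X m"
      and "topological_semilattice Y n \<and> Hausdorff_space Y \<and> well_separated Y n \<and> continuous_hom X m Y n h"
    then show "closedin Y (h ` topspace X)"
      using closed hausdorff_semilattice_hom.s_complete_image_mem[OF loc] by blast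
  next
    fix Y :: "'b topology" and n h
    assume "c_complete X m"
      and "topological_semilattice Y n \<and> Hausdorff_space Y \<and> down_open Y n \<and> continuous_hom X m Y n h"
    then show "closedin Y (h ` topspace X)"
      using closed hausdorff_semilattice_hom.c_complete_down_open_codomain_image_mem[OF loc] by blast
  next
    fix Y :: "'b topology" and n h
    assume "c_complete X m \<and> down_open X m"
      and "topological_semilattice Y n \<and> Hausdorff_space Y \<and> continuous_hom X m Y n h"
    then show "closedin Y (h ` topspace X)"
      using closed hausdorff_semilattice_hom.c_complete_down_open_domain_image_mem[OF loc] by blast
  qed
qed

end
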